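(* Let $X$ be a diffeological space, let $x\in X$, let $G$ be a group, and let $\varphi$ be a pointwise smooth action of $G$ on $X$. Let $G_x$ be the stabilizer of $x$ and let $\pi\colon X\to X/G_x$ be the standard projection. Then the map $T(\pi)\colon T_x(X)\to T_{[x]}(X/G_x)$ induces a smooth linear map $$(T_x(X))_{G_x}\to T_{[x]}(X/G_x),$$ where for a diffeological vector space $V$ with a smooth linear action of a group $H$, $V_H=V/\langle v-h\cdot v\mid v\in V,\ h\in H\rangle$ denotes the $H$-coinvariants, and $G_x$ acts on $T_x(X)$ by $g\mapsto T(\varphi_g)$.
   Context: A Euclidean open set is an open subset of $\mathbb{R}^n$ for some $n\ge 0$. A parametrization of a set $X$ is a map $U\to X$ with $U$ a Euclidean open set. A diffeology on $X$ is a set of parametrizations, called plots, such that: every constant parametrization is a plot; a parametrization $U\to X$ that restricts to a plot on each member of some open cover of $U$ is a plot; if $p\colon U\to X$ is a plot and $f\colon V\to U$ is a $C^\infty$ map from a Euclidean open set, then $p\circ f$ is a plot. A diffeological space is a set with a diffeology. A map $f\colon X\to Y$ of diffeological spaces is smooth if $f\circ p$ is a plot of $Y$ for every plot $p$ of $X$. Euclidean open sets carry the diffeology of all $C^\infty$ parametrizations. Subsets carry the subdiffeology (parametrizations that are plots of the ambient space), products the product diffeology (all components are plots), and quotients $X/{\sim}$ the quotient diffeology: a parametrization is a plot iff locally it is $\pi\circ f$ with $f$ a plot of $X$. A diffeological vector space is a real vector space with a diffeology making addition and scalar multiplication smooth; quotient vector spaces carry the quotient diffeology. An action of a group $G$ on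 $X$ is pointwise smooth if for each $g\in G$ the map $\varphi_g\colon X\to X$, $y\mapsto g\cdot y$, is smooth. $G_x=\{g\in G\mid g\cdot x=x\}$; $X/G_x$ is the orbit space with the quotient diffeology. Internal tangent space: let $p$ range over plots $p\colon U_p\to X$ with $0\in U_p$ and $p(0)=x$. Then $T_x(X)=\bigoplus_p T_0(U_p)/R$, where $R$ is spanned by all $v-w$ with $v\in T_0(U_p)$, $w\in T_0(U_q)$ such that $p=q\circ f$ for some smooth $f\colon U_p\to U_q$ with $f(0)=0$ and $df_0(v)=w$. The class of $v\in T_0(U_p)$ is written $[p,v]$. A smooth map $f\colon X\to Y$ induces the linear map $T(f)\colon T_x(X)\to T_{f(x)}(Y)$, $[p,v]\mapsto[f\circ p,v]$. Diffeology on $T_x(X)$: on $TX=\coprod_{x\in X}T_x(X)$ consider the diffeology generated by the maps $TU\to TX$ induced by plots $p\colon U\to X$ (sending $v\in T_uU$ to $[p(\cdot+u),v]\in T_{p(u)}(X)$); $TX$ is given the smallest diffeology containing it and making $TX\to X$ a diffeological vector space over $X$, i.e. making the projection, fibrewise addition $TX\times_X TX\to TX$, scalar multiplication $\mathbb{R}\times TX\to TX$ and the zero section $X\to TX$ smooth. $T_x(X)$ carries the subdiffeology of $TX$; it is then a diffeological vector space. (The diffeology generated by a family of parametrizations is the smallest diffeology containing it.) *)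

theory Defs
  imports
    "HOL-Analysis.Analysis"
    "HOL-Algebra.Group_Action"
    "HOL-Algebra.AbelCoset"
    "HOL-Algebra.Module"
begin

section \<open>Smooth maps between Euclidean open sets\<close>

text \<open>
  \<open>\<real>\<^sup>n\<close> is \<^term>\<open>Euclidean_space n\<close>, whose points are the functions \<open>nat \<Rightarrow> real\<close> that vanish
  at all indices \<open>i \<ge> n\<close>. In particular \<^term>\<open>\<lambda>_::nat. 0::real\<close> is the origin of every \<open>\<real>\<^sup>n\<close>.
\<close>

definition partial_deriv :: "nat \<Rightarrow> ((nat \<Rightarrow> real) \<Rightarrow> real) \<Rightarrow> (nat \<Rightarrow> real) \<Rightarrow> real" where
  "partial_deriv i g x = deriv (\<lambda>t. g (x(i := t))) (x i)"

text \<open>\<open>C\<^sup>k\<close> functions on an open subset \<open>U\<close> of \<open>\<real>\<^sup>n\<close>. The values of \<open>g\<close> outside \<open>U\<close> are irrelevant.\<close>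

primrec Ck_on :: "nat \<Rightarrow> nat \<Rightarrow> (nat \<Rightarrow> real) set \<Rightarrow> ((nat \<Rightarrow> real) \<Rightarrow> real) \<Rightarrow> bool" where
  "Ck_on 0 n U g \<longleftrightarrow> continuous_map (subtopology (Euclidean_space n) U) euclideanreal g"
| "Ck_on (Suc k) n U g \<longleftrightarrow>
     continuous_map (subtopology (Euclidean_space n) U) euclideanreal g \<and>
     (\<forall>i<n. (\<forall>x\<in>U. (\<lambda>t. g (x(i := t))) differentiable at (x i)) \<and>
            Ck_on k n U (partial_deriv i g))"

definition smooth_fun :: "nat \<Rightarrow> (nat \<Rightarrow> real) set \<Rightarrow> ((nat \<Rightarrow> real) \<Rightarrow> real) \<Rightarrow> bool" where
  "smooth_fun n U g \<longleftrightarrow> (\<forall>k. Ck_on k n U g)"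

text \<open>Smooth maps from \<open>U\<close>, open in \<open>\<real>\<^sup>n\<close>, to \<open>V\<close>, open in \<open>\<real>\<^sup>m\<close>.\<close>

definition smooth_euclidean ::
  "nat \<Rightarrow> (nat \<Rightarrow> real) set \<Rightarrow> nat \<Rightarrow> (nat \<Rightarrow> real) set \<Rightarrow> ((nat \<Rightarrow> real) \<Rightarrow> (nat \<Rightarrow> real)) \<Rightarrow> bool" where
  "smooth_euclidean n U m V f \<longleftrightarrow> f \<in> U \<rightarrow> V \<and> (\<forall>j<m. smooth_fun n U (\<lambda>x. f x j))"

text \<open>The differential \<open>df\<^sub>a : \<real>\<^sup>n \<rightarrow> \<real>\<^sup>m\<close>, given by the Jacobian matrix.\<close>

definition differential ::
  "nat \<Rightarrow> nat \<Rightarrow> ((nat \<Rightarrow> real) \<Rightarrow> (nat \<Rightarrow> real)) \<Rightarrow> (nat \<Rightarrow> real) \<Rightarrow> (nat \<Rightarrow> real) \<Rightarrow> (nat \<Rightarrow> real)" where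
  "differential n m f a v =
     (\<lambda>j. if j < m then (\<Sum>i<n. partial_deriv i (\<lambda>x. f x j) a * v i) else 0)"


section \<open>Diffeologies\<close>

text \<open>
  A parametrization \<open>U \<rightarrow> X\<close> is a triple \<open>(n, U, p)\<close> with \<open>U\<close> open in \<open>\<real>\<^sup>n\<close>. The function \<open>p\<close> is
  required to be extensional, so that equality of triples is equality of maps with domain \<open>U\<close>.
\<close>

type_synonym 'a param = "nat \<times> (nat \<Rightarrow> real) set \<times> ((nat \<Rightarrow> real) \<Rightarrow> 'a)"

definition parametrizations :: "'a set \<Rightarrow> 'a param set" where
  "parametrizations X = {(n, U, p). openin (Euclidean_space n) U \<and> p \<in> U \<rightarrow>\<^sub>E X}"

definition diffeology :: "'a set \<Rightarrow> 'a param set \<Rightarrow> bool" where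
  "diffeology X D \<longleftrightarrow>
     D \<subseteq> parametrizations X \<and>
     (\<forall>n U c. openin (Euclidean_space n) U \<and> c \<in> X \<longrightarrow> (n, U, \<lambda>u\<in>U. c) \<in> D) \<and>
     (\<forall>n U p. (n, U, p) \<in> parametrizations X \<and>
        (\<exists>\<V>. (\<forall>V\<in>\<V>. openin (Euclidean_space n) V \<and> (n, V, restrict p V) \<in> D) \<and> \<Union>\<V> = U)
        \<longrightarrow> (n, U, p) \<in> D) \<and>
     (\<forall>n U p m V f. (n, U, p) \<in> D \<and> openin (Euclidean_space m) V \<and> smooth_euclidean m V n U f
        \<longrightarrow> (m, V, compose V p f) \<in> D)"

definition smooth_map :: "'a set \<Rightarrow> 'a param set \<Rightarrow> 'b set \<Rightarrow> 'b param set \<Rightarrow> ('a \<Rightarrow> 'b) \<Rightarrow> bool" where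
  "smooth_map X D Y E f \<longleftrightarrow>
     f \<in> X \<rightarrow> Y \<and> (\<forall>n U p. (n, U, p) \<in> D \<longrightarrow> (n, U, compose U f p) \<in> E)"

definition generated_diffeology :: "'a set \<Rightarrow> 'a param set \<Rightarrow> 'a param set" where
  "generated_diffeology X F = \<Inter>{D. diffeology X D \<and> F \<subseteq> D}"

definition real_diffeology :: "real param set" where
  "real_diffeology = {(n, U, p) \<in> parametrizations UNIV. smooth_fun n U p}"

definition subdiffeology :: "'a param set \<Rightarrow> 'a set \<Rightarrow> 'a param set" where
  "subdiffeology D A = {(n, U, p) \<in> D. p \<in> U \<rightarrow> A}"

definition product_diffeology :: "'a param set \<Rightarrow> 'b param set \<Rightarrow> ('a \<times> 'b) param set" where
  "product_diffeology D E =
     {(n, U, p). p \<in> extensional U \<and> (n, U, compose U fst p) \<in> D \<and> (n, U, compose U snd p) \<in> E}"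

text \<open>The quotient diffeology on \<open>Y\<close> along a surjection \<open>\<pi>\<close> from the space with plots \<open>D\<close>.\<close>

definition quotient_diffeology :: "'a param set \<Rightarrow> ('a \<Rightarrow> 'b) \<Rightarrow> 'b set \<Rightarrow> 'b param set" where
  "quotient_diffeology D \<pi> Y =
     {(n, U, p) \<in> parametrizations Y.
        \<forall>u\<in>U. \<exists>V f. u \<in> V \<and> V \<subseteq> U \<and> openin (Euclidean_space n) V \<and>
          (n, V, f) \<in> D \<and> restrict p V = compose V \<pi> f}"


section \<open>Real vector spaces and diffeological vector spaces\<close>

definition real_ring :: "real ring" where
  "real_ring = \<lparr>carrier = UNIV, mult = (*), one = 1, zero = 0, add = (+)\<rparr>"

text \<open>
  A real vector space is a \<^const>\<open>Module.module\<close> over \<^const>\<open>real_ring\<close>; the fields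
  \<^const>\<open>monoid.mult\<close> and \<^const>\<open>monoid.one\<close> of the module record play no role.
\<close>

type_synonym 'v vec_space = "(real, 'v) module"

abbreviation real_vector_space :: "'v vec_space \<Rightarrow> bool" where
  "real_vector_space V \<equiv> Module.module real_ring V"

definition linear_map :: "'v vec_space \<Rightarrow> 'w vec_space \<Rightarrow> ('v \<Rightarrow> 'w) \<Rightarrow> bool" where
  "linear_map V W F \<longleftrightarrow>
     F \<in> carrier V \<rightarrow> carrier W \<and>
     (\<forall>v\<in>carrier V. \<forall>w\<in>carrier V. F (v \<oplus>\<^bsub>V\<^esub> w) = F v \<oplus>\<^bsub>W\<^esub> F w) \<and>
     (\<forall>r. \<forall>v\<in>carrier V. F (r \<odot>\<^bsub>V\<^esub> v) = r \<odot>\<^bsub>W\<^esub> F v)"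

definition linear_span :: "'v vec_space \<Rightarrow> 'v set \<Rightarrow> 'v set" where
  "linear_span V S = \<Inter>{N. submodule N real_ring V \<and> S \<subseteq> N}"

text \<open>The quotient \<open>V/N\<close> by a subspace; its points are the cosets \<open>N + v\<close>.\<close>

definition quotient_space :: "'v vec_space \<Rightarrow> 'v set \<Rightarrow> 'v set vec_space" where
  "quotient_space V N =
     \<lparr>carrier = {N +>\<^bsub>V\<^esub> v |v. v \<in> carrier V}, mult = undefined, one = undefined,
      zero = N, add = (\<lambda>A B. A <+>\<^bsub>V\<^esub> B),
      smult = (\<lambda>r A. \<Union>v\<in>A. N +>\<^bsub>V\<^esub> (r \<odot>\<^bsub>V\<^esub> v))\<rparr>"

definition diffeological_vector_space :: "'v vec_space \<Rightarrow> 'v param set \<Rightarrow> bool" where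
  "diffeological_vector_space V D \<longleftrightarrow>
     real_vector_space V \<and> diffeology (carrier V) D \<and>
     smooth_map (carrier V \<times> carrier V) (product_diffeology D D) (carrier V) D
       (\<lambda>(v, w). v \<oplus>\<^bsub>V\<^esub> w) \<and>
     smooth_map (UNIV \<times> carrier V) (product_diffeology real_diffeology D) (carrier V) D
       (\<lambda>(r, v). r \<odot>\<^bsub>V\<^esub> v)"

definition smooth_linear_map ::
  "'v vec_space \<Rightarrow> 'v param set \<Rightarrow> 'w vec_space \<Rightarrow> 'w param set \<Rightarrow> ('v \<Rightarrow> 'w) \<Rightarrow> bool" where
  "smooth_linear_map V D W E F \<longleftrightarrow> linear_map V W F \<and> smooth_map (carrier V) D (carrier W) E F"

definition smooth_linear_action ::
  "('g, 'z) monoid_scheme \<Rightarrow> 'v vec_space \<Rightarrow> 'v param set \<Rightarrow> ('g \<Rightarrow> 'v \<Rightarrow> 'v) \<Rightarrow> bool" where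
  "smooth_linear_action H V D \<alpha> \<longleftrightarrow>
     diffeological_vector_space V D \<and> group_action H (carrier V) \<alpha> \<and>
     (\<forall>h\<in>carrier H. smooth_linear_map V D V D (\<alpha> h))"

definition coinvariant_relations ::
  "('g, 'z) monoid_scheme \<Rightarrow> 'v vec_space \<Rightarrow> ('g \<Rightarrow> 'v \<Rightarrow> 'v) \<Rightarrow> 'v set" where
  "coinvariant_relations H V \<alpha> =
     linear_span V {v \<ominus>\<^bsub>V\<^esub> \<alpha> h v |v h. v \<in> carrier V \<and> h \<in> carrier H}"

definition coinvariants ::
  "('g, 'z) monoid_scheme \<Rightarrow> 'v vec_space \<Rightarrow> ('g \<Rightarrow> 'v \<Rightarrow> 'v) \<Rightarrow> 'v set vec_space" where
  "coinvariants H V \<alpha> = quotient_space V (coinvariant_relations H V \<alpha>)"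

definition coinvariant_class ::
  "('g, 'z) monoid_scheme \<Rightarrow> 'v vec_space \<Rightarrow> ('g \<Rightarrow> 'v \<Rightarrow> 'v) \<Rightarrow> 'v \<Rightarrow> 'v set" where
  "coinvariant_class H V \<alpha> v = coinvariant_relations H V \<alpha> +>\<^bsub>V\<^esub> v"

definition coinvariants_diffeology ::
  "('g, 'z) monoid_scheme \<Rightarrow> 'v vec_space \<Rightarrow> 'v param set \<Rightarrow> ('g \<Rightarrow> 'v \<Rightarrow> 'v) \<Rightarrow> 'v set param set" where
  "coinvariants_diffeology H V D \<alpha> =
     quotient_diffeology D (coinvariant_class H V \<alpha>) (carrier (coinvariants H V \<alpha>))"


section \<open>Internal tangent spaces\<close>

definition pointed_plots :: "'a param set \<Rightarrow> 'a \<Rightarrow> 'a param set" where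
  "pointed_plots D x = {(n, U, p) \<in> D. (\<lambda>_. 0) \<in> U \<and> p (\<lambda>_. 0) = x}"

text \<open>
  The direct sum of the spaces \<open>T\<^sub>0(U\<^sub>p) = \<real>\<^sup>n\<close> over all pointed plots: families of vectors with
  finite support.
\<close>

definition plot_sum :: "'a param set \<Rightarrow> 'a \<Rightarrow> ('a param \<Rightarrow> nat \<Rightarrow> real) vec_space" where
  "plot_sum D x =
     \<lparr>carrier = {\<xi>. (\<forall>P. if P \<in> pointed_plots D x then \<xi> P \<in> topspace (Euclidean_space (fst P))
                         else \<xi> P = (\<lambda>_. 0)) \<and>
                    finite {P. \<xi> P \<noteq> (\<lambda>_. 0)}},
      mult = undefined, one = undefined,
      zero = (\<lambda>_ _. 0), add = (\<lambda>\<xi> \<eta> P i. \<xi> P i + \<eta> P i),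
      smult = (\<lambda>r \<xi> P i. r * \<xi> P i)\<rparr>"

definition summand_vec :: "'a param \<Rightarrow> (nat \<Rightarrow> real) \<Rightarrow> 'a param \<Rightarrow> nat \<Rightarrow> real" where
  "summand_vec P v = (\<lambda>Q. if Q = P then v else (\<lambda>_. 0))"

definition tangent_relations :: "'a param set \<Rightarrow> 'a \<Rightarrow> ('a param \<Rightarrow> nat \<Rightarrow> real) set" where
  "tangent_relations D x =
     linear_span (plot_sum D x)
       {summand_vec (n, U, p) v \<ominus>\<^bsub>plot_sum D x\<^esub> summand_vec (m, W, q) w |n U p v m W q w.
          (n, U, p) \<in> pointed_plots D x \<and> (m, W, q) \<in> pointed_plots D x \<and>
          v \<in> topspace (Euclidean_space n) \<and> w \<in> topspace (Euclidean_space m) \<and>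
          (\<exists>f. smooth_euclidean n U m W f \<and> p = compose U q f \<and>
               f (\<lambda>_. 0) = (\<lambda>_. 0) \<and> differential n m f (\<lambda>_. 0) v = w)}"

definition tangent_space :: "'a param set \<Rightarrow> 'a \<Rightarrow> ('a param \<Rightarrow> nat \<Rightarrow> real) set vec_space" where
  "tangent_space D x = quotient_space (plot_sum D x) (tangent_relations D x)"

text \<open>The class \<open>[p, v]\<close>.\<close>

definition tangent_class ::
  "'a param set \<Rightarrow> 'a \<Rightarrow> 'a param \<Rightarrow> (nat \<Rightarrow> real) \<Rightarrow> ('a param \<Rightarrow> nat \<Rightarrow> real) set" where
  "tangent_class D x P v = tangent_relations D x +>\<^bsub>plot_sum D x\<^esub> summand_vec P v"

text \<open>
  \<open>T(f) : T\<^sub>x(X) \<rightarrow> T\<^bsub>f x\<^esub>(Y)\<close> is the linear map with \<open>[p, v] \<mapsto> [f \<circ> p, v]\<close>. For smooth \<open>f\<close> it exists,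
  and it is unique because the classes \<open>[p, v]\<close> span the domain.
\<close>

definition tangent_map ::
  "'a param set \<Rightarrow> 'a \<Rightarrow> 'b param set \<Rightarrow> ('a \<Rightarrow> 'b) \<Rightarrow>
   ('a param \<Rightarrow> nat \<Rightarrow> real) set \<Rightarrow> ('b param \<Rightarrow> nat \<Rightarrow> real) set" where
  "tangent_map D x E f =
     (THE F. F \<in> extensional (carrier (tangent_space D x)) \<and>
             linear_map (tangent_space D x) (tangent_space E (f x)) F \<and>
             (\<forall>n U p v. (n, U, p) \<in> pointed_plots D x \<and> v \<in> topspace (Euclidean_space n) \<longrightarrow>
                F (tangent_class D x (n, U, p) v) =
                tangent_class E (f x) (n, U, compose U f p) v))"


section \<open>The diffeology on the tangent bundle and on tangent spaces\<close>

definition tangent_bundle :: "'a set \<Rightarrow> 'a param set \<Rightarrow> ('a \<times> ('a param \<Rightarrow> nat \<Rightarrow> real) set) set" where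
  "tangent_bundle X D = (SIGMA x:X. carrier (tangent_space D x))"

text \<open>
  For \<open>U\<close> open in \<open>\<real>\<^sup>n\<close>, \<open>TU\<close> is the open subset \<open>U \<times> \<real>\<^sup>n\<close> of \<open>\<real>\<^bsup>2n\<^esup>\<close>: the first \<open>n\<close> coordinates are
  the base point, the last \<open>n\<close> coordinates are the vector.
\<close>

definition base_part :: "nat \<Rightarrow> (nat \<Rightarrow> real) \<Rightarrow> nat \<Rightarrow> real" where
  "base_part n w = (\<lambda>i. if i < n then w i else 0)"

definition vector_part :: "nat \<Rightarrow> (nat \<Rightarrow> real) \<Rightarrow> nat \<Rightarrow> real" where
  "vector_part n w = (\<lambda>i. if i < n then w (n + i) else 0)"

definition tangent_open :: "nat \<Rightarrow> (nat \<Rightarrow> real) set \<Rightarrow> (nat \<Rightarrow> real) set" where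
  "tangent_open n U = {w \<in> topspace (Euclidean_space (2 * n)). base_part n w \<in> U}"

text \<open>\<open>p(\<cdot> + u)\<close>, defined on \<open>U - u\<close>.\<close>

definition translate :: "(nat \<Rightarrow> real) \<Rightarrow> 'a param \<Rightarrow> 'a param" where
  "translate u = (\<lambda>(n, U, p).
     let W = {y \<in> topspace (Euclidean_space n). (\<lambda>i. y i + u i) \<in> U}
     in (n, W, \<lambda>y\<in>W. p (\<lambda>i. y i + u i)))"

text \<open>The map \<open>TU \<rightarrow> TX\<close> induced by a plot \<open>U \<rightarrow> X\<close>.\<close>

definition bundle_param ::
  "'a param set \<Rightarrow> 'a param \<Rightarrow> ('a \<times> ('a param \<Rightarrow> nat \<Rightarrow> real) set) param" where
  "bundle_param D = (\<lambda>(n, U, p).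
     (2 * n, tangent_open n U,
      \<lambda>w\<in>tangent_open n U.
        let u = base_part n w
        in (p u, tangent_class D (p u) (translate u (n, U, p)) (vector_part n w))))"

definition fibre_product :: "('a \<times> 'b) set \<Rightarrow> (('a \<times> 'b) \<times> ('a \<times> 'b)) set" where
  "fibre_product B = {(s, t). s \<in> B \<and> t \<in> B \<and> fst s = fst t}"

definition smooth_bundle_operations ::
  "'a set \<Rightarrow> 'a param set \<Rightarrow> ('a \<times> ('a param \<Rightarrow> nat \<Rightarrow> real) set) param set \<Rightarrow> bool" where
  "smooth_bundle_operations X D E \<longleftrightarrow>
     (let B = tangent_bundle X D in
      smooth_map B E X D fst \<and>
      smooth_map (fibre_product B) (subdiffeology (product_diffeology E E) (fibre_product B)) B E
        (\<lambda>(s, t). (fst s, snd s \<oplus>\<^bsub>tangent_space D (fst s)\<^esub> snd t)) \<and>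
      smooth_map (UNIV \<times> B) (product_diffeology real_diffeology E) B E
        (\<lambda>(r, t). (fst t, r \<odot>\<^bsub>tangent_space D (fst t)\<^esub> snd t)) \<and>
      smooth_map X D B E (\<lambda>x. (x, \<zero>\<^bsub>tangent_space D x\<^esub>)))"

definition tangent_bundle_diffeology ::
  "'a set \<Rightarrow> 'a param set \<Rightarrow> ('a \<times> ('a param \<Rightarrow> nat \<Rightarrow> real) set) param set" where
  "tangent_bundle_diffeology X D =
     \<Inter>{E. diffeology (tangent_bundle X D) E \<and>
          generated_diffeology (tangent_bundle X D) (bundle_param D ` D) \<subseteq> E \<and>
          smooth_bundle_operations X D E}"

text \<open>The subdiffeology of the fibre over \<open>x\<close>, with \<open>t\<close> in \<open>T\<^sub>x(X)\<close> identified with \<open>(x, t)\<close>.\<close>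

definition tangent_diffeology ::
  "'a set \<Rightarrow> 'a param set \<Rightarrow> 'a \<Rightarrow> ('a param \<Rightarrow> nat \<Rightarrow> real) set param set" where
  "tangent_diffeology X D x =
     {(n, U, p) \<in> parametrizations (carrier (tangent_space D x)).
        (n, U, \<lambda>u\<in>U. (x, p u)) \<in> tangent_bundle_diffeology X D}"


section \<open>Pointwise smooth actions\<close>

definition pointwise_smooth_action ::
  "('g, 'z) monoid_scheme \<Rightarrow> 'a set \<Rightarrow> 'a param set \<Rightarrow> ('g \<Rightarrow> 'a \<Rightarrow> 'a) \<Rightarrow> bool" where
  "pointwise_smooth_action G X D \<phi> \<longleftrightarrow>
     group_action G X \<phi> \<and> (\<forall>g\<in>carrier G. smooth_map X D X D (\<phi> g))"

definition stabilizer_group ::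
  "('g, 'z) monoid_scheme \<Rightarrow> ('g \<Rightarrow> 'a \<Rightarrow> 'a) \<Rightarrow> 'a \<Rightarrow> ('g, 'z) monoid_scheme" where
  "stabilizer_group G \<phi> x = G\<lparr>carrier := stabilizer G \<phi> x\<rparr>"

text \<open>The orbit space of an action of \<open>H\<close> on \<open>X\<close> is \<^term>\<open>orbits H X \<phi>\<close>.\<close>

definition orbit_diffeology ::
  "('g, 'z) monoid_scheme \<Rightarrow> 'a set \<Rightarrow> 'a param set \<Rightarrow> ('g \<Rightarrow> 'a \<Rightarrow> 'a) \<Rightarrow> 'a set param set" where
  "orbit_diffeology H X D \<phi> = quotient_diffeology D (orbit H \<phi>) (orbits H X \<phi>)"

end

theory Submission
  imports Defs
begin

text \<open>
  The pushforward of plots along a smooth map \<open>f\<close> respects the defining relations of the tangent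
  spaces, because \<open>p = q \<circ> g\<close> implies \<open>f \<circ> p = (f \<circ> q) \<circ> g\<close>; no chain rule is involved. This yields
  \<open>T(f)\<close>. For its smoothness, pull back along \<open>T(f)\<close> any diffeology admissible in the definition of
  the diffeology of \<open>TY\<close>, and intersect the result with the pullback of the diffeology of \<open>X\<close> along
  the bundle projection: this is admissible for \<open>TX\<close>, hence contains the diffeology of \<open>TX\<close>. Finally
  \<open>T(\<pi>) \<circ> T(\<phi>\<^sub>h) = T(\<pi> \<circ> \<phi>\<^sub>h) = T(\<pi>)\<close> for \<open>h\<close> in the stabilizer, so \<open>T(\<pi>)\<close> factors through the
  coinvariants, smoothly because these carry the quotient diffeology.
\<close>

section \<open>Smooth maps between Euclidean open sets\<close>

text \<open>The diffeology of TX is available only as an intersection of all admissible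
  diffeologies. Hence a map into TY is tested against each admissible diffeology of TY separately,
  while a plot of TX is exploited by exhibiting one suitable admissible diffeology of TX. The
  pullback along T(f) alone is not suitable: it makes the projection smooth only after composition
  with f, which says little about X when f collapses points, as pi does. This is why the pullback
  along the projection enters. T(f) is a definite description, so existence and uniqueness are both
  owed. Existence comes from pushing forward finite families of vectors, where vectors at plots with
  the same composite are added up; uniqueness holds because the classes [p, v] span. The same
  spanning argument gives T(id) = id and T(g o f) = T(g) o T(f), hence the group action on the
  tangent space. The stabilizer enters twice: \<open>\<phi> h x = x\<close> makes T of
  \<open>\<phi> h\<close> return to the fibre over x, and points in one orbit of the stabilizer have
  the same image under pi.\<close>

lemma Ck_on_mono: "Ck_on k n U g \<Longrightarrow> V \<subseteq> U \<Longrightarrow> Ck_on k n V g"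
  by (induction k arbitrary: g) (auto intro: continuous_map_from_subtopology_mono)

lemma smooth_fun_mono: "smooth_fun n U g \<Longrightarrow> V \<subseteq> U \<Longrightarrow> smooth_fun n V g"
  unfolding smooth_fun_def by (blast intro: Ck_on_mono)

lemma Ck_on_const: "Ck_on k n U (\<lambda>_. c)"
  \<comment> \<open>The constant is generalized because every partial derivative is again constant,
    with value 0.\<close>
  by (induction k arbitrary: c) (simp_all add: partial_deriv_def[abs_def])

lemma continuous_map_coordinate:
  "continuous_map (subtopology (Euclidean_space n) U) euclideanreal (\<lambda>x. x j)"
proof -
  have "continuous_map (subtopology (powertop_real UNIV) S) euclideanreal (\<lambda>x. x j)" for S
    by (intro continuous_map_from_subtopology continuous_map_product_projection) simp
  then show ?thesis
    unfolding Euclidean_space_def subtopology_subtopology by blast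
qed

text \<open>All partial derivatives are constants, so every order of differentiability follows by a
  case split on \<open>k\<close>. Both the projection \<open>base_part\<close> and the translations
  have coordinates of this shape.\<close>

lemma smooth_fun_shifted_coordinate: "smooth_fun n U (\<lambda>x. x j + c)"
proof -
  have pd: "partial_deriv i (\<lambda>x. x j + c) = (\<lambda>_. if i = j then 1 else 0)" for i
    by (auto simp: partial_deriv_def fun_eq_iff intro!: DERIV_imp_deriv derivative_eq_intros)
  have cont: "continuous_map (subtopology (Euclidean_space n) U) euclideanreal (\<lambda>x. x j + c)"
    by (intro continuous_map_add continuous_map_coordinate) simp
  have diff: "(\<lambda>t. (x(i := t)) j + c) differentiable at (x i)" for x :: "nat \<Rightarrow> real" and i
    by (cases "i = j") auto
  have "Ck_on k n U (\<lambda>x. x j + c)" for k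
    using cont diff by (cases k) (auto simp: pd Ck_on_const simp del: fun_upd_apply)
  then show ?thesis by (simp add: smooth_fun_def)
qed

lemma smooth_fun_coordinate: "smooth_fun n U (\<lambda>x. x j)"
  using smooth_fun_shifted_coordinate[of n U j 0] by simp

lemma smooth_euclidean_restrict:
  assumes "smooth_euclidean n U m W f" "V \<subseteq> U" "f \<in> V \<rightarrow> W'"
  shows "smooth_euclidean n V m W' f"
  using assms unfolding smooth_euclidean_def by (blast intro: smooth_fun_mono)

text \<open>Smoothness constrains only the coordinates below \<open>m\<close>. The remaining ones
  vanish because the values lie in \<open>W\<close>, so on \<open>U\<close> the map coincides with
  its truncation, whose continuity is a coordinatewise matter.\<close>

lemma smooth_euclidean_continuous_map:
  assumes f: "smooth_euclidean n U m W f" and U: "U \<subseteq> topspace (Euclidean_space n)"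
    and W: "W \<subseteq> topspace (Euclidean_space m)"
  shows "continuous_map (subtopology (Euclidean_space n) U) (Euclidean_space m) f"
proof -
  have "continuous_map (subtopology (Euclidean_space n) U) euclideanreal (\<lambda>x. f x j)" if "j < m" for j
  proof -
    have "Ck_on 0 n U (\<lambda>x. f x j)"
      using f that unfolding smooth_euclidean_def smooth_fun_def by blast
    then show ?thesis by simp
  qed
  then have "continuous_map (subtopology (Euclidean_space n) U) (Euclidean_space m)
      (\<lambda>x i. if i < m then f x i else 0)"
    by (simp add: continuous_map_componentwise_Euclidean_space)
  moreover have "(\<lambda>i. if i < m then f x i else 0) = f x" if "x \<in> U" for x
  proof -
    have "f x \<in> topspace (Euclidean_space m)"
      using f W that by (auto simp: smooth_euclidean_def)
    then show ?thesis by (auto simp: topspace_Euclidean_space fun_eq_iff)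
  qed
  ultimately show ?thesis
    using U by (elim continuous_map_eq) auto
qed

text \<open>The common source of openness for the domains \<open>tangent_open\<close>, for
  translated domains, and for the preimages on which local lifts to a quotient are pulled
  back.\<close>

lemma openin_smooth_euclidean_vimage:
  assumes f: "smooth_euclidean n U m W f"
    and U: "openin (Euclidean_space n) U" and W: "W \<subseteq> topspace (Euclidean_space m)"
    and V: "openin (Euclidean_space m) V"
  shows "openin (Euclidean_space n) {u \<in> U. f u \<in> V}"
proof -
  have "openin (subtopology (Euclidean_space n) U)
      {u \<in> topspace (subtopology (Euclidean_space n) U). f u \<in> V}"
    using smooth_euclidean_continuous_map[OF f openin_subset[OF U] W] V
    by (rule openin_continuous_map_preimage)
  moreover have "topspace (subtopology (Euclidean_space n) U) = U"
    using openin_subset[OF U] by auto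
  \<comment> \<open>Open in the subspace \<open>U\<close>, which is itself open, hence open in the
    whole space.\<close>
  ultimately show ?thesis
    using openin_trans_full[OF _ U] by metis
qed

lemma openin_tangent_open:
  assumes U: "openin (Euclidean_space n) U"
  shows "openin (Euclidean_space (2 * n)) (tangent_open n U)"
proof -
  have "smooth_euclidean (2 * n) (topspace (Euclidean_space (2 * n))) n
      (topspace (Euclidean_space n)) (base_part n)"
    by (auto simp: smooth_euclidean_def base_part_def smooth_fun_coordinate topspace_Euclidean_space)
  from openin_smooth_euclidean_vimage[OF this openin_topspace order_refl U]
  show ?thesis by (simp add: tangent_open_def)
qed

lemma smooth_euclidean_base_part: "smooth_euclidean (2 * n) (tangent_open n U) n U (base_part n)"
  by (auto simp: smooth_euclidean_def base_part_def tangent_open_def smooth_fun_coordinate)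

text \<open>The set \<open>U - u\<close> that is let-bound inside \<open>translate\<close>, named so
  that its openness and the smoothness of the translation on it can be stated.\<close>

definition translated_domain :: "nat \<Rightarrow> (nat \<Rightarrow> real) set \<Rightarrow> (nat \<Rightarrow> real) \<Rightarrow> (nat \<Rightarrow> real) set" where
  "translated_domain n U u = {y \<in> topspace (Euclidean_space n). (\<lambda>i. y i + u i) \<in> U}"

lemma smooth_euclidean_translation:
  "smooth_euclidean n (translated_domain n U u) n U (\<lambda>y i. y i + u i)"
  by (auto simp: smooth_euclidean_def translated_domain_def smooth_fun_shifted_coordinate)

lemma openin_translated_domain:
  assumes U: "openin (Euclidean_space n) U" and u: "u \<in> U"
  shows "openin (Euclidean_space n) (translated_domain n U u)"
proof -
  \<comment> \<open>The coordinates of \<open>u\<close> from \<open>n\<close> on vanish, so adding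
    \<open>u\<close> does not lead out of the Euclidean space.\<close>
  have "u \<in> topspace (Euclidean_space n)"
    using openin_subset[OF U] u by blast
  then have "smooth_euclidean n (topspace (Euclidean_space n)) n
      (topspace (Euclidean_space n)) (\<lambda>y i. y i + u i)"
    by (auto simp: smooth_euclidean_def smooth_fun_shifted_coordinate topspace_Euclidean_space)
  from openin_smooth_euclidean_vimage[OF this openin_topspace order_refl U]
  show ?thesis by (simp add: translated_domain_def)
qed

lemma translate_eq:
  "translate u (n, U, p) =
     (n, translated_domain n U u, \<lambda>y\<in>translated_domain n U u. p (\<lambda>i. y i + u i))"
  by (simp add: translate_def translated_domain_def Let_def)

section \<open>Diffeologies\<close>

lemma diffeologyI:
  assumes "\<And>n U p. (n, U, p) \<in> D \<Longrightarrow> openin (Euclidean_space n) U \<and> p \<in> U \<rightarrow>\<^sub>E X"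
    and "\<And>n U c. openin (Euclidean_space n) U \<Longrightarrow> c \<in> X \<Longrightarrow> (n, U, \<lambda>u\<in>U. c) \<in> D"
    and "\<And>n U p \<V>. openin (Euclidean_space n) U \<Longrightarrow> p \<in> U \<rightarrow>\<^sub>E X \<Longrightarrow>
          (\<And>V. V \<in> \<V> \<Longrightarrow> openin (Euclidean_space n) V) \<Longrightarrow>
          (\<And>V. V \<in> \<V> \<Longrightarrow> (n, V, restrict p V) \<in> D) \<Longrightarrow> \<Union>\<V> = U \<Longrightarrow> (n, U, p) \<in> D"
    and "\<And>n U p m V f. (n, U, p) \<in> D \<Longrightarrow> openin (Euclidean_space m) V \<Longrightarrow>
          smooth_euclidean m V n U f \<Longrightarrow> (m, V, compose V p f) \<in> D"
  shows "diffeology X D"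
  unfolding diffeology_def parametrizations_def
  apply (intro conjI subsetI allI impI; (elim conjE exE)?)
  subgoal for P using assms(1) by (cases P) auto
  subgoal using assms(2) by blast
  subgoal for n U p \<V> using assms(3)[of n U p \<V>] by auto
  subgoal using assms(4) by blast
  done

context
  fixes X :: "'a set" and D :: "'a param set"
  assumes D: "diffeology X D"
begin

lemma plot_openin: "(n, U, p) \<in> D \<Longrightarrow> openin (Euclidean_space n) U"
  and plot_PiE: "(n, U, p) \<in> D \<Longrightarrow> p \<in> U \<rightarrow>\<^sub>E X"
  using D by (auto simp: diffeology_def parametrizations_def)

lemma plot_in_space: "(n, U, p) \<in> D \<Longrightarrow> u \<in> U \<Longrightarrow> p u \<in> X"
  using plot_PiE by (blast dest: PiE_mem)

lemma plot_const: "openin (Euclidean_space n) U \<Longrightarrow> c \<in> X \<Longrightarrow> (n, U, \<lambda>u\<in>U. c) \<in> D"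
  using D by (simp add: diffeology_def)

text \<open>The covering axiom in pointwise form: the family of all open subsets on which
  \<open>p\<close> is a plot serves as the cover.\<close>

lemma plot_local:
  assumes "openin (Euclidean_space n) U" "p \<in> U \<rightarrow>\<^sub>E X"
    and "\<And>u. u \<in> U \<Longrightarrow> \<exists>V. u \<in> V \<and> V \<subseteq> U \<and> openin (Euclidean_space n) V \<and> (n, V, restrict p V) \<in> D"
  shows "(n, U, p) \<in> D"
proof -
  let ?\<V> = "{V. V \<subseteq> U \<and> openin (Euclidean_space n) V \<and> (n, V, restrict p V) \<in> D}"
  have "\<Union>?\<V> = U" using assms(3) by blast
  moreover have "(n, U, p) \<in> parametrizations X"
    using assms by (simp add: parametrizations_def)
  moreover have "\<forall>n U p. (n, U, p) \<in> parametrizations X \<and>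
        (\<exists>\<V>. (\<forall>V\<in>\<V>. openin (Euclidean_space n) V \<and> (n, V, restrict p V) \<in> D) \<and> \<Union>\<V> = U)
        \<longrightarrow> (n, U, p) \<in> D"
    using D unfolding diffeology_def by (elim conjE)
  moreover have "\<forall>V\<in>?\<V>. openin (Euclidean_space n) V \<and> (n, V, restrict p V) \<in> D"
    by blast
  ultimately show ?thesis by blast
qed

lemma plot_compose:
  "(n, U, p) \<in> D \<Longrightarrow> openin (Euclidean_space m) V \<Longrightarrow> smooth_euclidean m V n U f \<Longrightarrow>
   (m, V, compose V p f) \<in> D"
  using D unfolding diffeology_def by blast

text \<open>Precomposition with a smooth translation moves the base point to the origin. This makes
  the translated plot an admissible index of the direct sum at \<open>p u\<close>, as
  \<open>bundle_param\<close> requires.\<close>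

lemma plot_translate:
  assumes p: "(n, U, p) \<in> D" and u: "u \<in> U"
  shows "translate u (n, U, p) \<in> pointed_plots D (p u)"
proof -
  have "openin (Euclidean_space n) (translated_domain n U u)"
    using plot_openin[OF p] u by (rule openin_translated_domain)
  from plot_compose[OF p this smooth_euclidean_translation]
  have "(n, translated_domain n U u, \<lambda>y\<in>translated_domain n U u. p (\<lambda>i. y i + u i)) \<in> D"
    by (simp add: compose_def)
  moreover have "(\<lambda>_. 0) \<in> translated_domain n U u"
    using u by (simp add: translated_domain_def topspace_Euclidean_space)
  ultimately show ?thesis
    by (simp add: translate_eq pointed_plots_def)
qed

end

text \<open>For \<open>h\<close> from \<open>A\<close> into the space of \<open>E\<close>, the
  largest diffeology on \<open>A\<close> that makes \<open>h\<close> smooth.\<close>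

definition pullback_diffeology :: "'a set \<Rightarrow> ('a \<Rightarrow> 'b) \<Rightarrow> 'b param set \<Rightarrow> 'a param set" where
  "pullback_diffeology A h E = {(n, U, p) \<in> parametrizations A. (n, U, compose U h p) \<in> E}"

lemma diffeology_pullback:
  assumes E: "diffeology B E" and h: "h \<in> A \<rightarrow> B"
  shows "diffeology A (pullback_diffeology A h E)"
proof (rule diffeologyI)
  fix n U p assume "(n, U, p) \<in> pullback_diffeology A h E"
  then show "openin (Euclidean_space n) U \<and> p \<in> U \<rightarrow>\<^sub>E A"
    by (simp add: pullback_diffeology_def parametrizations_def)
next
  fix n U c assume U: "openin (Euclidean_space n) U" and c: "c \<in> A"
  have "compose U h (\<lambda>u\<in>U. c) = (\<lambda>u\<in>U. h c)" by (auto simp: compose_def fun_eq_iff)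
  then show "(n, U, \<lambda>u\<in>U. c) \<in> pullback_diffeology A h E"
    using plot_const[OF E U, of "h c"] U c h
    by (auto simp: pullback_diffeology_def parametrizations_def)
next
  fix n U p \<V>
  assume U: "openin (Euclidean_space n) U" and p: "p \<in> U \<rightarrow>\<^sub>E A"
    and op: "\<And>V. V \<in> \<V> \<Longrightarrow> openin (Euclidean_space n) V"
    and loc: "\<And>V. V \<in> \<V> \<Longrightarrow> (n, V, restrict p V) \<in> pullback_diffeology A h E"
    and cover: "\<Union>\<V> = U"
  have "(n, U, compose U h p) \<in> E"
  proof (rule plot_local[OF E U])
    show "compose U h p \<in> U \<rightarrow>\<^sub>E B"
      using p h by (auto simp: compose_def)
    fix u assume "u \<in> U"
    then obtain V where V: "V \<in> \<V>" "u \<in> V" using cover by blast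
    have "V \<subseteq> U" using V cover by blast
    then have "compose V h (restrict p V) = restrict (compose U h p) V"
      by (auto simp: compose_def fun_eq_iff)
    then have "(n, V, restrict (compose U h p) V) \<in> E"
      using loc[OF V(1)] by (simp add: pullback_diffeology_def)
    then show "\<exists>V. u \<in> V \<and> V \<subseteq> U \<and> openin (Euclidean_space n) V \<and>
        (n, V, restrict (compose U h p) V) \<in> E"
      using V op \<open>V \<subseteq> U\<close> by blast
  qed
  then show "(n, U, p) \<in> pullback_diffeology A h E"
    using U p by (simp add: pullback_diffeology_def parametrizations_def)
next
  fix n U p m V f
  assume p: "(n, U, p) \<in> pullback_diffeology A h E" and V: "openin (Euclidean_space m) V"
    and f: "smooth_euclidean m V n U f"
  have fV: "f v \<in> U" if "v \<in> V" for v
    using f that by (auto simp: smooth_euclidean_def)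
  have "compose V (compose U h p) f = compose V h (compose V p f)"
    using fV by (auto simp: compose_def fun_eq_iff)
  moreover have "(m, V, compose V (compose U h p) f) \<in> E"
    using p by (intro plot_compose[OF E _ V f]) (simp add: pullback_diffeology_def)
  moreover have "compose V p f \<in> V \<rightarrow>\<^sub>E A"
    using p fV by (auto simp: pullback_diffeology_def parametrizations_def compose_def)
  ultimately show "(m, V, compose V p f) \<in> pullback_diffeology A h E"
    using V by (simp add: pullback_diffeology_def parametrizations_def)
qed

text \<open>The factor \<open>parametrizations X\<close> gives the empty family a meaning: the
  intersection is then the diffeology of all parametrizations instead of the universal set.\<close>

lemma diffeology_Inter:
  assumes \<E>: "\<And>E. E \<in> \<E> \<Longrightarrow> diffeology X E"
  shows "diffeology X (parametrizations X \<inter> \<Inter>\<E>)"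
proof (rule diffeologyI)
  fix n U p \<V>
  assume U: "openin (Euclidean_space n) U" and p: "p \<in> U \<rightarrow>\<^sub>E X"
    and op: "\<And>V. V \<in> \<V> \<Longrightarrow> openin (Euclidean_space n) V"
    and loc: "\<And>V. V \<in> \<V> \<Longrightarrow> (n, V, restrict p V) \<in> parametrizations X \<inter> \<Inter>\<E>"
    and cover: "\<Union>\<V> = U"
  have "(n, U, p) \<in> E" if E: "E \<in> \<E>" for E
  proof (rule plot_local[OF \<E>[OF E] U p])
    fix u assume "u \<in> U"
    then obtain V where "V \<in> \<V>" "u \<in> V" using cover by blast
    then have "u \<in> V \<and> V \<subseteq> U \<and> openin (Euclidean_space n) V \<and> (n, V, restrict p V) \<in> E"
      using op loc E cover by auto
    then show "\<exists>V. u \<in> V \<and> V \<subseteq> U \<and> openin (Euclidean_space n) V \<and> (n, V, restrict p V) \<in> E" ..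
  qed
  then show "(n, U, p) \<in> parametrizations X \<inter> \<Inter>\<E>"
    using U p by (simp add: parametrizations_def)
next
  fix n U p m V f
  assume p: "(n, U, p) \<in> parametrizations X \<inter> \<Inter>\<E>" and V: "openin (Euclidean_space m) V"
    and f: "smooth_euclidean m V n U f"
  have "compose V p f \<in> V \<rightarrow>\<^sub>E X"
    using p f by (auto simp: parametrizations_def smooth_euclidean_def compose_def Pi_iff)
  moreover have "(m, V, compose V p f) \<in> E" if E: "E \<in> \<E>" for E
    using p E by (intro plot_compose[OF \<E>[OF E] _ V f]) blast
  ultimately show "(m, V, compose V p f) \<in> parametrizations X \<inter> \<Inter>\<E>"
    using V by (simp add: parametrizations_def)
qed (use plot_const[OF \<E>] in \<open>simp_all add: parametrizations_def\<close>)

section \<open>Quotient diffeologies and their universal property\<close>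

lemma quotient_diffeologyI:
  assumes "openin (Euclidean_space n) U" "p \<in> U \<rightarrow>\<^sub>E Y"
    and "\<And>u. u \<in> U \<Longrightarrow> \<exists>V f. u \<in> V \<and> V \<subseteq> U \<and> openin (Euclidean_space n) V \<and>
          (n, V, f) \<in> D \<and> restrict p V = compose V \<pi> f"
  shows "(n, U, p) \<in> quotient_diffeology D \<pi> Y"
  using assms by (simp add: quotient_diffeology_def parametrizations_def)

text \<open>Constants lift because \<open>\<pi>\<close> is onto, locality is built into the
  definition, and a reparametrization pulls local lifts back to preimages of their domains.\<close>

lemma diffeology_quotient:
  assumes D: "diffeology X D" and \<pi>: "\<pi> ` X = Y"
  shows "diffeology Y (quotient_diffeology D \<pi> Y)"
proof (rule diffeologyI)
  fix n U p assume "(n, U, p) \<in> quotient_diffeology D \<pi> Y"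
  then show "openin (Euclidean_space n) U \<and> p \<in> U \<rightarrow>\<^sub>E Y"
    by (simp add: quotient_diffeology_def parametrizations_def)
next
  fix n U c assume U: "openin (Euclidean_space n) U" and c: "c \<in> Y"
  obtain a where a: "a \<in> X" "c = \<pi> a" using c \<pi> by blast
  have a': "(n, U, \<lambda>u\<in>U. a) \<in> D" using plot_const[OF D U a(1)] .
  have eq: "restrict (\<lambda>u\<in>U. c) U = compose U \<pi> (\<lambda>u\<in>U. a)"
    using a by (auto simp: compose_def fun_eq_iff)
  show "(n, U, \<lambda>u\<in>U. c) \<in> quotient_diffeology D \<pi> Y"
  proof (rule quotient_diffeologyI[OF U])
    show "(\<lambda>u\<in>U. c) \<in> U \<rightarrow>\<^sub>E Y" using c by simp
    fix u assume "u \<in> U"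
    then have "u \<in> U \<and> U \<subseteq> U \<and> openin (Euclidean_space n) U \<and>
        (n, U, \<lambda>u\<in>U. a) \<in> D \<and> restrict (\<lambda>u\<in>U. c) U = compose U \<pi> (\<lambda>u\<in>U. a)"
      using U a' eq by (intro conjI subset_refl)
    then show "\<exists>V f. u \<in> V \<and> V \<subseteq> U \<and> openin (Euclidean_space n) V \<and>
        (n, V, f) \<in> D \<and> restrict (\<lambda>u\<in>U. c) V = compose V \<pi> f"
      by (intro exI)
  qed
next
  fix n U p \<V>
  assume U: "openin (Euclidean_space n) U" and p: "p \<in> U \<rightarrow>\<^sub>E Y"
    and loc: "\<And>V. V \<in> \<V> \<Longrightarrow> (n, V, restrict p V) \<in> quotient_diffeology D \<pi> Y"
    and cover: "\<Union>\<V> = U"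
  have "\<exists>V f. u \<in> V \<and> V \<subseteq> U \<and> openin (Euclidean_space n) V \<and>
      (n, V, f) \<in> D \<and> restrict p V = compose V \<pi> f" if u: "u \<in> U" for u
  proof -
    obtain W where W: "W \<in> \<V>" "u \<in> W" using cover u by blast
    then obtain V f where V: "u \<in> V" "V \<subseteq> W" "openin (Euclidean_space n) V" "(n, V, f) \<in> D"
      "restrict (restrict p W) V = compose V \<pi> f"
      using loc[OF W(1)] unfolding quotient_diffeology_def by blast
    moreover have "restrict (restrict p W) V = restrict p V"
      using V(2) by (simp add: Int_absorb1)
    moreover have "V \<subseteq> U" using V(2) W cover by blast
    ultimately show ?thesis by metis
  qed
  then show "(n, U, p) \<in> quotient_diffeology D \<pi> Y"
    using U p by (simp add: quotient_diffeology_def parametrizations_def)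
next
  fix n U p m V f
  assume p: "(n, U, p) \<in> quotient_diffeology D \<pi> Y" and V: "openin (Euclidean_space m) V"
    and f: "smooth_euclidean m V n U f"
  have fV: "f v \<in> U" if "v \<in> V" for v
    using f that by (auto simp: smooth_euclidean_def)
  have U: "U \<subseteq> topspace (Euclidean_space n)"
    using p by (auto simp: quotient_diffeology_def parametrizations_def openin_subset)
  have "\<exists>V' g. v \<in> V' \<and> V' \<subseteq> V \<and> openin (Euclidean_space m) V' \<and>
      (m, V', g) \<in> D \<and> restrict (compose V p f) V' = compose V' \<pi> g" if v: "v \<in> V" for v
  proof -
    obtain W g where W: "f v \<in> W" "W \<subseteq> U" "openin (Euclidean_space n) W" "(n, W, g) \<in> D"
      "restrict p W = compose W \<pi> g"
      using p fV[OF v] unfolding quotient_diffeology_def by blast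
    \<comment> \<open>The lift \<open>g\<close> exists only over \<open>W\<close>, a neighbourhood
      of \<open>f v\<close>, so \<open>f\<close> is cut down to the preimage of \<open>W\<close>,
      which is open by continuity.\<close>
    let ?V = "{v \<in> V. f v \<in> W}"
    have op: "openin (Euclidean_space m) ?V"
      using openin_smooth_euclidean_vimage[OF f V U W(3)] .
    have "smooth_euclidean m ?V n W f"
      using f by (rule smooth_euclidean_restrict) auto
    from plot_compose[OF D W(4) op this] have "(m, ?V, compose ?V g f) \<in> D" .
    moreover have "restrict (compose V p f) ?V = compose ?V \<pi> (compose ?V g f)"
    proof
      fix y show "restrict (compose V p f) ?V y = compose ?V \<pi> (compose ?V g f) y"
        using fun_cong[OF W(5), of "f y"] by (auto simp: compose_def restrict_def)
    qed
    moreover have "v \<in> ?V" "?V \<subseteq> V" using v W(1) by auto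
    ultimately have "v \<in> ?V \<and> ?V \<subseteq> V \<and> openin (Euclidean_space m) ?V \<and>
      (m, ?V, compose ?V g f) \<in> D \<and>
      restrict (compose V p f) ?V = compose ?V \<pi> (compose ?V g f)"
      using op by (intro conjI)
    then show ?thesis by (intro exI)
  qed
  moreover have "compose V p f \<in> V \<rightarrow>\<^sub>E Y"
    using p fV by (auto simp: quotient_diffeology_def parametrizations_def compose_def)
  ultimately show "(m, V, compose V p f) \<in> quotient_diffeology D \<pi> Y"
    using V by (simp add: quotient_diffeology_def parametrizations_def)
qed

lemma smooth_map_quotient:
  assumes D: "diffeology X D" and \<pi>: "\<pi> ` X = Y"
  shows "smooth_map X D Y (quotient_diffeology D \<pi> Y) \<pi>"
proof -
  have "(n, U, compose U \<pi> p) \<in> quotient_diffeology D \<pi> Y" if p: "(n, U, p) \<in> D" for n U p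
  proof -
    have "compose U \<pi> p \<in> U \<rightarrow>\<^sub>E Y"
      using plot_in_space[OF D p] \<pi> by (auto simp: compose_def)
    moreover have "restrict (compose U \<pi> p) U = compose U \<pi> p"
      by (auto simp: compose_def)
    ultimately show ?thesis
      using plot_openin[OF D p] p
      by (intro quotient_diffeologyI exI[of _ U] exI[of _ p]) auto
  qed
  then show ?thesis using \<pi> by (auto simp: smooth_map_def)
qed

text \<open>Universal property: where a plot lifts as \<open>\<pi>\<close> after \<open>g\<close>,
  its image under \<open>F\<close> is \<open>f\<close> after \<open>g\<close>, and being a plot of
  \<open>E\<close> is a local condition.\<close>

lemma smooth_map_from_quotient:
  assumes D: "diffeology X D" and \<pi>: "\<pi> ` X = Y" and E: "diffeology Z E"
    and f: "smooth_map X D Z E f" and F: "\<And>x. x \<in> X \<Longrightarrow> F (\<pi> x) = f x"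
  shows "smooth_map Y (quotient_diffeology D \<pi> Y) Z E F"
proof -
  have FZ: "F \<in> Y \<rightarrow> Z" using f F \<pi> by (auto simp: smooth_map_def)
  have "(n, U, compose U F p) \<in> E" if p: "(n, U, p) \<in> quotient_diffeology D \<pi> Y" for n U p
  proof (rule plot_local[OF E])
    show "openin (Euclidean_space n) U" "compose U F p \<in> U \<rightarrow>\<^sub>E Z"
      using p FZ by (auto simp: quotient_diffeology_def parametrizations_def compose_def)
    fix u assume "u \<in> U"
    then obtain V g where V: "u \<in> V" "V \<subseteq> U" "openin (Euclidean_space n) V" "(n, V, g) \<in> D"
      "restrict p V = compose V \<pi> g"
      using p unfolding quotient_diffeology_def by blast
    have "restrict (compose U F p) V = compose V f g"
    proof
      fix y show "restrict (compose U F p) V y = compose V f g y"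
        using fun_cong[OF V(5), of y] F plot_in_space[OF D V(4), of y] V(2)
        by (auto simp: compose_def restrict_def)
    qed
    moreover have "(n, V, compose V f g) \<in> E" using f V(4) by (simp add: smooth_map_def)
    ultimately show "\<exists>V. u \<in> V \<and> V \<subseteq> U \<and> openin (Euclidean_space n) V \<and>
        (n, V, restrict (compose U F p) V) \<in> E"
      using V by auto
  qed
  then show ?thesis using FZ by (simp add: smooth_map_def)
qed

lemma product_plotI:
  assumes "(n, U, a) \<in> D" "(n, U, b) \<in> E" "a \<in> extensional U" "b \<in> extensional U"
  shows "(n, U, \<lambda>u\<in>U. (a u, b u)) \<in> product_diffeology D E"
proof -
  have "compose U fst (\<lambda>u\<in>U. (a u, b u)) = a" "compose U snd (\<lambda>u\<in>U. (a u, b u)) = b"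
    using assms(3,4) by (auto simp: compose_def fun_eq_iff extensional_def)
  then show ?thesis using assms(1,2) by (simp add: product_diffeology_def)
qed

lemma product_plotD:
  assumes "(n, U, p) \<in> product_diffeology D E"
  shows "(n, U, \<lambda>u\<in>U. fst (p u)) \<in> D" "(n, U, \<lambda>u\<in>U. snd (p u)) \<in> E" "p \<in> extensional U"
  using assms by (simp_all add: product_diffeology_def compose_def)

lemma plot_extensional: "diffeology X D \<Longrightarrow> (n, U, p) \<in> D \<Longrightarrow> p \<in> extensional U"
  using plot_PiE by (fastforce simp: PiE_def)

lemma real_plot_extensional: "(n, U, p) \<in> real_diffeology \<Longrightarrow> p \<in> extensional U"
  by (simp add: real_diffeology_def parametrizations_def PiE_def)

section \<open>Linear algebra over the reals\<close>

lemma cring_real_ring: "cring real_ring"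
  by (rule cringI; (rule abelian_groupI comm_monoidI)?)
     (auto simp: real_ring_def algebra_simps intro: exI[of _ "- x" for x])

lemma real_ring_simps [simp]:
  "carrier real_ring = UNIV" "x \<oplus>\<^bsub>real_ring\<^esub> y = x + y" "x \<otimes>\<^bsub>real_ring\<^esub> y = x * y"
  "\<one>\<^bsub>real_ring\<^esub> = 1" "\<zero>\<^bsub>real_ring\<^esub> = 0"
  by (simp_all add: real_ring_def)

text \<open>Additive inverses are asked for with the explicit witness
  \<open>(- 1) \<odot> v\<close>, which is a plain calculation both for families of vectors and for
  cosets.\<close>

lemma real_vector_spaceI:
  fixes V :: "'v vec_space" (structure)
  assumes "\<And>v w. v \<in> carrier V \<Longrightarrow> w \<in> carrier V \<Longrightarrow> v \<oplus> w \<in> carrier V"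
    and "\<zero> \<in> carrier V"
    and "\<And>r v. v \<in> carrier V \<Longrightarrow> r \<odot> v \<in> carrier V"
    and "\<And>u v w. u \<in> carrier V \<Longrightarrow> v \<in> carrier V \<Longrightarrow> w \<in> carrier V \<Longrightarrow>
          (u \<oplus> v) \<oplus> w = u \<oplus> (v \<oplus> w)"
    and "\<And>v w. v \<in> carrier V \<Longrightarrow> w \<in> carrier V \<Longrightarrow> v \<oplus> w = w \<oplus> v"
    and "\<And>v. v \<in> carrier V \<Longrightarrow> \<zero> \<oplus> v = v"
    and "\<And>v. v \<in> carrier V \<Longrightarrow> ((- 1) \<odot> v) \<oplus> v = \<zero>"
    and "\<And>a b v. v \<in> carrier V \<Longrightarrow> (a + b) \<odot> v = (a \<odot> v) \<oplus> (b \<odot> v)"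
    and "\<And>a v w. v \<in> carrier V \<Longrightarrow> w \<in> carrier V \<Longrightarrow> a \<odot> (v \<oplus> w) = (a \<odot> v) \<oplus> (a \<odot> w)"
    and "\<And>a b v. v \<in> carrier V \<Longrightarrow> (a * b) \<odot> v = a \<odot> (b \<odot> v)"
    and "\<And>v. v \<in> carrier V \<Longrightarrow> 1 \<odot> v = v"
  shows "real_vector_space V"
proof (rule moduleI[OF cring_real_ring])
  show "abelian_group V"
  proof (rule abelian_groupI)
    fix v assume "v \<in> carrier V"
    then show "\<exists>w\<in>carrier V. w \<oplus> v = \<zero>"
      using assms(3)[of v "- 1"] assms(7)[of v] by blast
  qed (fact assms)+
qed (simp_all add: assms)

lemma linear_map_carrier: "linear_map V W F \<Longrightarrow> v \<in> carrier V \<Longrightarrow> F v \<in> carrier W"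
  and linear_map_add: "linear_map V W F \<Longrightarrow> v \<in> carrier V \<Longrightarrow> w \<in> carrier V \<Longrightarrow>
    F (v \<oplus>\<^bsub>V\<^esub> w) = F v \<oplus>\<^bsub>W\<^esub> F w"
  and linear_map_smult: "linear_map V W F \<Longrightarrow> v \<in> carrier V \<Longrightarrow> F (r \<odot>\<^bsub>V\<^esub> v) = r \<odot>\<^bsub>W\<^esub> F v"
  by (auto simp: linear_map_def)

lemma linear_map_compose:
  "linear_map V W F \<Longrightarrow> linear_map W Z G \<Longrightarrow> linear_map V Z (\<lambda>v. G (F v))"
  unfolding linear_map_def Pi_iff by simp

lemma linear_map_restrict:
  assumes "real_vector_space V" and F: "linear_map V W F"
  shows "linear_map V W (restrict F (carrier V))"
proof -
  interpret module real_ring V by fact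
  have "r \<odot>\<^bsub>V\<^esub> v \<in> carrier V" if "v \<in> carrier V" for r v
    using smult_closed[of r v] that by simp
  then show ?thesis
    using F by (simp add: linear_map_def Pi_iff)
qed

lemma linear_map_zero:
  assumes V: "real_vector_space V" and W: "real_vector_space W" and F: "linear_map V W F"
  shows "F \<zero>\<^bsub>V\<^esub> = \<zero>\<^bsub>W\<^esub>"
proof -
  interpret V: module real_ring V by fact
  interpret W: module real_ring W by fact
  have "F (0 \<odot>\<^bsub>V\<^esub> \<zero>\<^bsub>V\<^esub>) = 0 \<odot>\<^bsub>W\<^esub> F \<zero>\<^bsub>V\<^esub>"
    by (rule linear_map_smult[OF F V.M.zero_closed])
  then show ?thesis
    using V.smult_l_null[of "\<zero>\<^bsub>V\<^esub>"] W.smult_l_null[of "F \<zero>\<^bsub>V\<^esub>"]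
      linear_map_carrier[OF F V.M.zero_closed] by simp
qed

lemma linear_map_minus:
  assumes V: "real_vector_space V" and W: "real_vector_space W" and F: "linear_map V W F"
    and v: "v \<in> carrier V" and w: "w \<in> carrier V"
  shows "F (v \<ominus>\<^bsub>V\<^esub> w) = F v \<ominus>\<^bsub>W\<^esub> F w"
proof -
  interpret V: module real_ring V by fact
  interpret W: module real_ring W by fact
  have "F (\<ominus>\<^bsub>V\<^esub> w) \<oplus>\<^bsub>W\<^esub> F w = \<zero>\<^bsub>W\<^esub>"
    using linear_map_add[OF F, of "\<ominus>\<^bsub>V\<^esub> w" w] linear_map_zero[OF V W F] w
    by (simp add: V.M.l_neg)
  then have "F (\<ominus>\<^bsub>V\<^esub> w) = \<ominus>\<^bsub>W\<^esub> F w"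
    using w linear_map_carrier[OF F] by (intro W.M.minus_equality[symmetric]) auto
  then show ?thesis
    using linear_map_add[OF F v, of "\<ominus>\<^bsub>V\<^esub> w"] w by (simp add: a_minus_def)
qed

text \<open>Serves to check equality of linear maps on generators only. Taking the zero map for
  \<open>G\<close> yields kernels.\<close>

lemma submodule_equalizer:
  assumes V: "real_vector_space V" and W: "real_vector_space W"
    and F: "linear_map V W F" and G: "linear_map V W G"
  shows "submodule {v \<in> carrier V. F v = G v} real_ring V"
proof -
  interpret V: module real_ring V by fact
  \<comment> \<open>\<open>submoduleI\<close> demands closure under additive inverses; writing these
    as multiples by -1 reduces that to compatibility with scalars.\<close>
  have neg: "\<ominus>\<^bsub>V\<^esub> v = (- 1) \<odot>\<^bsub>V\<^esub> v" if "v \<in> carrier V" for v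
  proof -
    have "((- 1) + 1) \<odot>\<^bsub>V\<^esub> v = (- 1) \<odot>\<^bsub>V\<^esub> v \<oplus>\<^bsub>V\<^esub> 1 \<odot>\<^bsub>V\<^esub> v"
      using V.smult_l_distr[of "- 1" 1 v] that by simp
    then have "(- 1) \<odot>\<^bsub>V\<^esub> v \<oplus>\<^bsub>V\<^esub> v = \<zero>\<^bsub>V\<^esub>"
      using V.smult_l_null[of v] V.smult_one[of v] that by simp
    then show ?thesis
      using that V.smult_closed[of "- 1" v] by (intro V.M.minus_equality) auto
  qed
  show ?thesis
    using linear_map_zero[OF V W F] linear_map_zero[OF V W G] V.smult_closed
    by (intro V.submoduleI)
       (auto simp: linear_map_add[OF F] linear_map_add[OF G] neg
         linear_map_smult[OF F] linear_map_smult[OF G])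
qed

lemma submodule_kernel:
  assumes V: "real_vector_space V" and W: "real_vector_space W" and F: "linear_map V W F"
  shows "submodule {v \<in> carrier V. F v = \<zero>\<^bsub>W\<^esub>} real_ring V"
proof (rule submodule_equalizer[OF V W F])
  interpret W: module real_ring W by fact
  show "linear_map V W (\<lambda>_. \<zero>\<^bsub>W\<^esub>)"
    using W.smult_r_null by (simp add: linear_map_def)
qed

lemma linear_span_least: "submodule N real_ring V \<Longrightarrow> S \<subseteq> N \<Longrightarrow> linear_span V S \<subseteq> N"
  by (auto simp: linear_span_def)

lemma linear_span_superset: "S \<subseteq> linear_span V S"
  by (auto simp: linear_span_def)

text \<open>As \<open>S\<close> lies in the carrier, the carrier is itself one of the submodules
  being intersected, and this keeps the span inside it.\<close>

lemma submodule_linear_span: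
  assumes V: "real_vector_space V" and S: "S \<subseteq> carrier V"
  shows "submodule (linear_span V S) real_ring V"
proof -
  interpret module real_ring V by fact
  show ?thesis
  proof (rule submoduleI)
    fix r v assume "v \<in> linear_span V S"
    then show "r \<odot>\<^bsub>V\<^esub> v \<in> linear_span V S"
      by (auto simp: linear_span_def intro: submodule.smult_closed)
  next
    show "linear_span V S \<subseteq> carrier V"
      using linear_span_least[OF carrier_is_submodule S] .
    show "\<zero>\<^bsub>V\<^esub> \<in> linear_span V S"
      unfolding linear_span_def
      using submodule.axioms(1) subgroup.one_closed by fastforce
  qed (auto simp: linear_span_def dest: submoduleE(3,4,5))
qed

section \<open>Quotients of a real vector space by a subspace\<close>

locale real_subspace =
  fixes V :: "'v vec_space" and N
  assumes real_vector_space: "real_vector_space V"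
    and submodule: "submodule N real_ring V"
begin

sublocale V: module real_ring V
  by (rule real_vector_space)

sublocale abelian_subgroup N V
  using submodule.axioms(1)[OF submodule]
  by (intro abelian_subgroupI3 additive_subgroup.intro V.M.abelian_group_axioms)

lemma coset_eq_iff:
  assumes "v \<in> carrier V" "w \<in> carrier V"
  shows "N +>\<^bsub>V\<^esub> v = N +>\<^bsub>V\<^esub> w \<longleftrightarrow> v \<ominus>\<^bsub>V\<^esub> w \<in> N"
proof
  assume "N +>\<^bsub>V\<^esub> v = N +>\<^bsub>V\<^esub> w"
  then have "N +>\<^bsub>V\<^esub> (v \<ominus>\<^bsub>V\<^esub> w) = N"
    unfolding a_minus_def using assms a_subset by (intro V.M.a_coset_add_inv2)
  then show "v \<ominus>\<^bsub>V\<^esub> w \<in> N"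
    using assms by (intro V.M.a_coset_join1[OF _ _ a_subgroup]) auto
next
  assume "v \<ominus>\<^bsub>V\<^esub> w \<in> N"
  then have "N +>\<^bsub>V\<^esub> (v \<ominus>\<^bsub>V\<^esub> w) = N"
    using assms by (intro V.M.a_coset_join2[OF _ a_subgroup]) auto
  then show "N +>\<^bsub>V\<^esub> v = N +>\<^bsub>V\<^esub> w"
    using assms a_subset by (intro V.M.a_coset_add_inv1) (auto simp: a_minus_def)
qed

text \<open>\<open>quotient_space\<close> scales a coset by a union over all its representatives, so
  that none has to be chosen. All members of the union coincide, because \<open>r\<close> times the
  difference of two representatives stays in \<open>N\<close>.\<close>

lemma smult_coset:
  assumes v: "v \<in> carrier V"
  shows "(\<Union>w\<in>N +>\<^bsub>V\<^esub> v. N +>\<^bsub>V\<^esub> (r \<odot>\<^bsub>V\<^esub> w)) = N +>\<^bsub>V\<^esub> (r \<odot>\<^bsub>V\<^esub> v)"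
proof -
  have "N +>\<^bsub>V\<^esub> (r \<odot>\<^bsub>V\<^esub> w) = N +>\<^bsub>V\<^esub> (r \<odot>\<^bsub>V\<^esub> v)" if w: "w \<in> N +>\<^bsub>V\<^esub> v" for w
  proof -
    have wV: "w \<in> carrier V" using w v a_subset V.M.a_r_coset_subset_G by blast
    have "N +>\<^bsub>V\<^esub> v = N +>\<^bsub>V\<^esub> w"
      using w v a_subgroup by (rule V.M.a_repr_independence)
    then have "r \<odot>\<^bsub>V\<^esub> (w \<ominus>\<^bsub>V\<^esub> v) \<in> N"
      using coset_eq_iff[OF wV v] submodule.smult_closed[OF submodule] by simp
    moreover have "r \<odot>\<^bsub>V\<^esub> (w \<ominus>\<^bsub>V\<^esub> v) = r \<odot>\<^bsub>V\<^esub> w \<ominus>\<^bsub>V\<^esub> r \<odot>\<^bsub>V\<^esub> v"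
      using v wV by (simp add: a_minus_def V.smult_r_distr V.smult_r_minus)
    ultimately show ?thesis
      using coset_eq_iff v wV V.smult_closed by simp
  qed
  then show ?thesis using a_rcos_self[OF v] by blast
qed

text \<open>The zero is presented as the coset of zero rather than as \<open>N\<close>, so that
  every operation is expressed on cosets of representatives.\<close>

lemma quotient_space_simps:
  "carrier (quotient_space V N) = (\<lambda>v. N +>\<^bsub>V\<^esub> v) ` carrier V"
  "\<zero>\<^bsub>quotient_space V N\<^esub> = N +>\<^bsub>V\<^esub> \<zero>\<^bsub>V\<^esub>"
  "v \<in> carrier V \<Longrightarrow> w \<in> carrier V \<Longrightarrow>
     (N +>\<^bsub>V\<^esub> v) \<oplus>\<^bsub>quotient_space V N\<^esub> (N +>\<^bsub>V\<^esub> w) = N +>\<^bsub>V\<^esub> (v \<oplus>\<^bsub>V\<^esub> w)"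
  "v \<in> carrier V \<Longrightarrow> r \<odot>\<^bsub>quotient_space V N\<^esub> (N +>\<^bsub>V\<^esub> v) = N +>\<^bsub>V\<^esub> (r \<odot>\<^bsub>V\<^esub> v)"
  using a_subset by (auto simp: quotient_space_def a_rcos_sum smult_coset)

lemma linear_map_coset: "linear_map V (quotient_space V N) (\<lambda>v. N +>\<^bsub>V\<^esub> v)"
  by (auto simp: linear_map_def quotient_space_simps)

lemma real_vector_space_quotient: "real_vector_space (quotient_space V N)"
proof (rule real_vector_spaceI)
  have *: "(- 1) \<odot>\<^bsub>V\<^esub> v \<oplus>\<^bsub>V\<^esub> v = \<zero>\<^bsub>V\<^esub>" if "v \<in> carrier V" for v
    using V.smult_l_distr[of "- 1" 1 v] V.smult_l_null[of v] V.smult_one[of v] that by simp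
  fix v assume "v \<in> carrier (quotient_space V N)"
  then show "(- 1) \<odot>\<^bsub>quotient_space V N\<^esub> v \<oplus>\<^bsub>quotient_space V N\<^esub> v = \<zero>\<^bsub>quotient_space V N\<^esub>"
    using V.smult_closed by (auto simp: quotient_space_simps *)
qed (use V.smult_closed V.smult_l_distr V.smult_assoc1 V.smult_one in
     \<open>auto simp: quotient_space_simps V.M.a_ac V.smult_r_distr\<close>)

text \<open>\<open>F\<close> evaluates \<open>f\<close> on a chosen representative. The choice is
  immaterial, since two representatives differ by an element of \<open>N\<close>, which
  \<open>f\<close> sends to zero.\<close>

lemma linear_map_quotient_lift:
  assumes W: "real_vector_space W" and f: "linear_map V W f"
    and null: "\<And>v. v \<in> N \<Longrightarrow> f v = \<zero>\<^bsub>W\<^esub>"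
  shows "\<exists>F. linear_map (quotient_space V N) W F \<and> (\<forall>v\<in>carrier V. F (N +>\<^bsub>V\<^esub> v) = f v)"
proof -
  interpret W: module real_ring W by fact
  have well: "f v = f w"
    if "v \<in> carrier V" "w \<in> carrier V" "N +>\<^bsub>V\<^esub> v = N +>\<^bsub>V\<^esub> w" for v w
  proof -
    have "f v \<ominus>\<^bsub>W\<^esub> f w = \<zero>\<^bsub>W\<^esub>"
      using linear_map_minus[OF real_vector_space W f that(1,2)] coset_eq_iff[OF that(1,2)]
        null that(3) by simp
    moreover have "f v = (f v \<ominus>\<^bsub>W\<^esub> f w) \<oplus>\<^bsub>W\<^esub> f w"
      using linear_map_carrier[OF f that(1)] linear_map_carrier[OF f that(2)]
      by (simp add: a_minus_def W.M.a_assoc W.M.l_neg)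
    ultimately show ?thesis
      using linear_map_carrier[OF f that(2)] by simp
  qed
  define F where "F A = f (SOME v. v \<in> carrier V \<and> A = N +>\<^bsub>V\<^esub> v)" for A
  have F: "F (N +>\<^bsub>V\<^esub> v) = f v" if v: "v \<in> carrier V" for v
  proof -
    let ?w = "SOME w. w \<in> carrier V \<and> N +>\<^bsub>V\<^esub> v = N +>\<^bsub>V\<^esub> w"
    have "\<exists>w. w \<in> carrier V \<and> N +>\<^bsub>V\<^esub> v = N +>\<^bsub>V\<^esub> w" using v by blast
    from someI_ex[OF this] have "f v = f ?w" using well[OF v] by blast
    then show ?thesis by (simp add: F_def)
  qed
  have "linear_map (quotient_space V N) W F"
    unfolding linear_map_def
  proof (intro conjI ballI allI funcsetI; (simp only: quotient_space_simps(1), elim imageE)?)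
    fix A v assume "v \<in> carrier V" "A = N +>\<^bsub>V\<^esub> v"
    then show "F A \<in> carrier W"
      by (simp add: F linear_map_carrier[OF f])
  next
    fix A B v w assume "v \<in> carrier V" "A = N +>\<^bsub>V\<^esub> v" "w \<in> carrier V" "B = N +>\<^bsub>V\<^esub> w"
    then show "F (A \<oplus>\<^bsub>quotient_space V N\<^esub> B) = F A \<oplus>\<^bsub>W\<^esub> F B"
      by (simp add: F quotient_space_simps(3) linear_map_add[OF f])
  next
    fix r A v assume v: "v \<in> carrier V" "A = N +>\<^bsub>V\<^esub> v"
    have "r \<odot>\<^bsub>V\<^esub> v \<in> carrier V" using v by (intro V.smult_closed) simp_all
    then show "F (r \<odot>\<^bsub>quotient_space V N\<^esub> A) = r \<odot>\<^bsub>W\<^esub> F A"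
      using v by (simp add: F quotient_space_simps(4) linear_map_smult[OF f])
  qed
  with F show ?thesis by blast
qed

end

section \<open>Tangent spaces\<close>

lemma plot_sum_simps:
  "\<zero>\<^bsub>plot_sum D x\<^esub> = (\<lambda>_ _. 0)"
  "\<xi> \<oplus>\<^bsub>plot_sum D x\<^esub> \<eta> = (\<lambda>P i. \<xi> P i + \<eta> P i)"
  "r \<odot>\<^bsub>plot_sum D x\<^esub> \<xi> = (\<lambda>P i. r * \<xi> P i)"
  by (simp_all add: plot_sum_def)

text \<open>\<open>S\<close> need only contain the support. For a sum of families the union of the
  two supports will do, although cancellation may shrink the true support.\<close>

lemma plot_sum_carrierI:
  assumes "\<And>P i. P \<in> pointed_plots D x \<Longrightarrow> i \<ge> fst P \<Longrightarrow> \<xi> P i = 0"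
    and "\<And>P i. P \<notin> pointed_plots D x \<Longrightarrow> \<xi> P i = 0"
    and "finite S" "\<And>P. P \<notin> S \<Longrightarrow> \<xi> P = (\<lambda>_. 0)"
  shows "\<xi> \<in> carrier (plot_sum D x)"
proof -
  have "{P. \<xi> P \<noteq> (\<lambda>_. 0)} \<subseteq> S" using assms(4) by blast
  then show ?thesis
    using assms(1-3) finite_subset by (auto simp: plot_sum_def topspace_Euclidean_space)
qed

lemma plot_sum_carrierD:
  assumes "\<xi> \<in> carrier (plot_sum D x)"
  shows "P \<in> pointed_plots D x \<Longrightarrow> i \<ge> fst P \<Longrightarrow> \<xi> P i = 0"
    and "P \<notin> pointed_plots D x \<Longrightarrow> \<xi> P = (\<lambda>_. 0)"
    and "finite {P. \<xi> P \<noteq> (\<lambda>_. 0)}"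
proof -
  have *: "\<forall>P. if P \<in> pointed_plots D x then \<xi> P \<in> topspace (Euclidean_space (fst P)) else \<xi> P = (\<lambda>_. 0)"
    and "finite {P. \<xi> P \<noteq> (\<lambda>_. 0)}"
    using assms by (simp_all add: plot_sum_def del: split_paired_All)
  then show "finite {P. \<xi> P \<noteq> (\<lambda>_. 0)}" by simp
  show "P \<in> pointed_plots D x \<Longrightarrow> i \<ge> fst P \<Longrightarrow> \<xi> P i = 0"
    using *[rule_format, of P] by (simp add: topspace_Euclidean_space)
  show "P \<notin> pointed_plots D x \<Longrightarrow> \<xi> P = (\<lambda>_. 0)"
    using *[rule_format, of P] by simp
qed

lemma real_vector_space_plot_sum: "real_vector_space (plot_sum D x)"
proof (rule real_vector_spaceI)
  fix \<xi> \<eta> assume *: "\<xi> \<in> carrier (plot_sum D x)" "\<eta> \<in> carrier (plot_sum D x)"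
  show "\<xi> \<oplus>\<^bsub>plot_sum D x\<^esub> \<eta> \<in> carrier (plot_sum D x)"
    using *[THEN plot_sum_carrierD(1)] *[THEN plot_sum_carrierD(2)] *[THEN plot_sum_carrierD(3)]
    by (intro plot_sum_carrierI[where S = "{P. \<xi> P \<noteq> (\<lambda>_. 0)} \<union> {P. \<eta> P \<noteq> (\<lambda>_. 0)}"])
       (simp_all add: plot_sum_simps)
next
  show "\<zero>\<^bsub>plot_sum D x\<^esub> \<in> carrier (plot_sum D x)"
    by (rule plot_sum_carrierI[where S = "{}"]) (simp_all add: plot_sum_simps)
next
  fix r \<xi> assume *: "\<xi> \<in> carrier (plot_sum D x)"
  show "r \<odot>\<^bsub>plot_sum D x\<^esub> \<xi> \<in> carrier (plot_sum D x)"
    using *[THEN plot_sum_carrierD(1)] *[THEN plot_sum_carrierD(2)] *[THEN plot_sum_carrierD(3)]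
    by (intro plot_sum_carrierI[where S = "{P. \<xi> P \<noteq> (\<lambda>_. 0)}"]) (simp_all add: plot_sum_simps)
qed (simp_all add: plot_sum_simps algebra_simps)

lemma summand_vec_carrier:
  assumes "P \<in> pointed_plots D x" "v \<in> topspace (Euclidean_space (fst P))"
  shows "summand_vec P v \<in> carrier (plot_sum D x)"
  using assms
  by (intro plot_sum_carrierI[where S = "{P}"])
     (auto simp: summand_vec_def topspace_Euclidean_space)

text \<open>The summands span the direct sum: by induction on a finite set containing the support,
  the component at one plot is split off. At an index that is not a pointed plot the component is
  zero and the smaller set already contains the support.\<close>

lemma plot_sum_subset_submodule:
  assumes N: "submodule N real_ring (plot_sum D x)"
    and gen: "\<And>P v. P \<in> pointed_plots D x \<Longrightarrow> v \<in> topspace (Euclidean_space (fst P)) \<Longrightarrow>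
      summand_vec P v \<in> N"
  shows "carrier (plot_sum D x) \<subseteq> N"
proof
  interpret real_subspace "plot_sum D x" N
    using real_vector_space_plot_sum N by (rule real_subspace.intro)
  have *: "\<xi> \<in> N" if "finite S" "\<xi> \<in> carrier (plot_sum D x)" "\<And>P. P \<notin> S \<Longrightarrow> \<xi> P = (\<lambda>_. 0)" for \<xi> S
    using that
  proof (induction S arbitrary: \<xi> rule: finite_induct)
    case empty
    then have "\<xi> = \<zero>\<^bsub>plot_sum D x\<^esub>" by (auto simp: plot_sum_simps)
    then show ?case by simp
  next
    case (insert P S)
    note \<xi> = plot_sum_carrierD[OF insert.prems(1)]
    show ?case
    proof (cases "P \<in> pointed_plots D x")
      case True
      have "\<xi>(P := (\<lambda>_. 0)) \<in> N"
      proof (rule insert.IH)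
        show "\<xi>(P := (\<lambda>_. 0)) \<in> carrier (plot_sum D x)"
          using \<xi>(1,2) insert.hyps(1) insert.prems(2)
          by (intro plot_sum_carrierI[where S = S]) auto
      qed (use insert.prems(2) in auto)
      moreover have "summand_vec P (\<xi> P) \<in> N"
        using \<xi>(1) True by (intro gen) (simp_all add: topspace_Euclidean_space)
      moreover have "\<xi> = \<xi>(P := (\<lambda>_. 0)) \<oplus>\<^bsub>plot_sum D x\<^esub> summand_vec P (\<xi> P)"
        by (auto simp: plot_sum_simps summand_vec_def fun_eq_iff)
      ultimately show ?thesis using a_closed by metis
    next
      case False
      then have "\<xi> Q = (\<lambda>_. 0)" if "Q \<notin> S" for Q
        using \<xi>(2) insert.prems(2) that by (cases "Q = P") simp_all
      with insert.prems(1) show ?thesis by (rule insert.IH)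
    qed
  qed
  fix \<xi> assume \<xi>: "\<xi> \<in> carrier (plot_sum D x)"
  show "\<xi> \<in> N"
    using *[OF plot_sum_carrierD(3)[OF \<xi>] \<xi>] by simp
qed

text \<open>The spanning set that occurs inside \<open>tangent_relations\<close>, named so that
  pushing it forward along a smooth map can be stated.\<close>

definition tangent_generators :: "'a param set \<Rightarrow> 'a \<Rightarrow> ('a param \<Rightarrow> nat \<Rightarrow> real) set" where
  "tangent_generators D x =
     {summand_vec (n, U, p) v \<ominus>\<^bsub>plot_sum D x\<^esub> summand_vec (m, W, q) w |n U p v m W q w.
        (n, U, p) \<in> pointed_plots D x \<and> (m, W, q) \<in> pointed_plots D x \<and>
        v \<in> topspace (Euclidean_space n) \<and> w \<in> topspace (Euclidean_space m) \<and>
        (\<exists>f. smooth_euclidean n U m W f \<and> p = compose U q f \<and>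
             f (\<lambda>_. 0) = (\<lambda>_. 0) \<and> differential n m f (\<lambda>_. 0) v = w)}"

lemma tangent_relations_eq: "tangent_relations D x = linear_span (plot_sum D x) (tangent_generators D x)"
  by (simp add: tangent_relations_def tangent_generators_def)

lemma tangent_generators_subset: "tangent_generators D x \<subseteq> tangent_relations D x"
  unfolding tangent_relations_eq by (rule linear_span_superset)

interpretation tangent: real_subspace "plot_sum D x" "tangent_relations D x" for D x
proof (rule real_subspace.intro[OF real_vector_space_plot_sum])
  interpret V: module real_ring "plot_sum D x" by (rule real_vector_space_plot_sum)
  have "tangent_generators D x \<subseteq> carrier (plot_sum D x)"
    unfolding tangent_generators_def by (auto intro!: V.M.minus_closed summand_vec_carrier)
  then show "submodule (tangent_relations D x) real_ring (plot_sum D x)"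
    unfolding tangent_relations_eq by (intro submodule_linear_span real_vector_space_plot_sum)
qed

lemmas real_vector_space_tangent_space =
  tangent.real_vector_space_quotient[folded tangent_space_def]

lemma tangent_class_carrier:
  "P \<in> pointed_plots D x \<Longrightarrow> v \<in> topspace (Euclidean_space (fst P)) \<Longrightarrow>
   tangent_class D x P v \<in> carrier (tangent_space D x)"
  unfolding tangent_class_def tangent_space_def tangent.quotient_space_simps
  by (intro imageI summand_vec_carrier)

text \<open>The classes [p, v] span: pulled back to the direct sum, the equalizer of the two maps is
  a subspace containing every summand. Uniqueness of T(f) and functoriality both rest on
  this.\<close>

lemma tangent_space_linear_eqI:
  assumes W: "real_vector_space W"
    and F: "linear_map (tangent_space D x) W F" and G: "linear_map (tangent_space D x) W G"
    and eq: "\<And>n U p v. (n, U, p) \<in> pointed_plots D x \<Longrightarrow> v \<in> topspace (Euclidean_space n) \<Longrightarrow>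
      F (tangent_class D x (n, U, p) v) = G (tangent_class D x (n, U, p) v)"
    and t: "t \<in> carrier (tangent_space D x)"
  shows "F t = G t"
proof -
  let ?c = "\<lambda>\<xi>. tangent_relations D x +>\<^bsub>plot_sum D x\<^esub> \<xi>"
  have c: "linear_map (plot_sum D x) (tangent_space D x) ?c"
    unfolding tangent_space_def by (rule tangent.linear_map_coset)
  have "carrier (plot_sum D x) \<subseteq> {\<xi> \<in> carrier (plot_sum D x). F (?c \<xi>) = G (?c \<xi>)}"
  proof (rule plot_sum_subset_submodule)
    show "submodule {\<xi> \<in> carrier (plot_sum D x). F (?c \<xi>) = G (?c \<xi>)} real_ring (plot_sum D x)"
      using linear_map_compose[OF c F] linear_map_compose[OF c G]
      by (rule submodule_equalizer[OF real_vector_space_plot_sum W])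
    fix P v assume "P \<in> pointed_plots D x" "v \<in> topspace (Euclidean_space (fst P))"
    then show "summand_vec P v \<in> {\<xi> \<in> carrier (plot_sum D x). F (?c \<xi>) = G (?c \<xi>)}"
      using eq[of "fst P" "fst (snd P)" "snd (snd P)" v]
      by (simp add: summand_vec_carrier tangent_class_def)
  qed
  then show ?thesis
    using t by (auto simp: tangent_space_def tangent.quotient_space_simps)
qed

section \<open>The induced linear map T(f)\<close>

definition plot_map :: "('a \<Rightarrow> 'b) \<Rightarrow> 'a param \<Rightarrow> 'b param" where
  "plot_map f = (\<lambda>(n, U, p). (n, U, compose U f p))"

lemma fst_plot_map [simp]: "fst (plot_map f P) = fst P"
  by (simp add: plot_map_def split_beta)

text \<open>Different plots may have the same composite with \<open>f\<close>, so the value at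
  \<open>Q\<close> adds up all vectors at plots lying over \<open>Q\<close>. Restricting to nonzero
  vectors keeps the index set finite on the carrier; a sum over an infinite set would be 0 by
  convention.\<close>

definition plot_sum_map ::
  "('a \<Rightarrow> 'b) \<Rightarrow> ('a param \<Rightarrow> nat \<Rightarrow> real) \<Rightarrow> 'b param \<Rightarrow> nat \<Rightarrow> real" where
  "plot_sum_map f \<xi> = (\<lambda>Q i. \<Sum>P | \<xi> P \<noteq> (\<lambda>_. 0) \<and> plot_map f P = Q. \<xi> P i)"

text \<open>Frees the index set from the support, so that several families can be summed over one
  common finite set, as additivity requires.\<close>

lemma plot_sum_map_eq:
  assumes S: "finite S" "\<And>P. P \<notin> S \<Longrightarrow> \<xi> P = (\<lambda>_. 0)"
  shows "plot_sum_map f \<xi> Q i = (\<Sum>P\<in>S. if plot_map f P = Q then \<xi> P i else 0)"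
proof -
  have "(\<Sum>P\<in>S. if plot_map f P = Q then \<xi> P i else 0) = (\<Sum>P | P \<in> S \<and> plot_map f P = Q. \<xi> P i)"
    using S(1) by (rule sum.inter_filter[symmetric])
  also have "\<dots> = plot_sum_map f \<xi> Q i"
    unfolding plot_sum_map_def using S by (intro sum.mono_neutral_right) auto
  finally show ?thesis by simp
qed

lemma plot_sum_map_summand_vec: "plot_sum_map f (summand_vec P v) = summand_vec (plot_map f P) v"
proof (intro ext)
  fix Q i
  have "plot_sum_map f (summand_vec P v) Q i =
      (\<Sum>P'\<in>{P}. if plot_map f P' = Q then summand_vec P v P' i else 0)"
    by (rule plot_sum_map_eq) (auto simp: summand_vec_def)
  then show "plot_sum_map f (summand_vec P v) Q i = summand_vec (plot_map f P) v Q i"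
    by (simp add: summand_vec_def)
qed

context
  fixes X :: "'a set" and D :: "'a param set" and Y :: "'b set" and E :: "'b param set" and f
  assumes f: "smooth_map X D Y E f"
begin

lemma plot_map_pointed: "P \<in> pointed_plots D x \<Longrightarrow> plot_map f P \<in> pointed_plots E (f x)"
  using f by (auto simp: pointed_plots_def plot_map_def smooth_map_def compose_eq)

lemma linear_map_plot_sum_map: "linear_map (plot_sum D x) (plot_sum E (f x)) (plot_sum_map f)"
  unfolding linear_map_def
proof (intro conjI ballI allI funcsetI)
  fix \<xi> assume \<xi>: "\<xi> \<in> carrier (plot_sum D x)"
  let ?S = "{P. \<xi> P \<noteq> (\<lambda>_. 0)}"
  note D = plot_sum_carrierD[OF \<xi>]
  show "plot_sum_map f \<xi> \<in> carrier (plot_sum E (f x))"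
  proof (rule plot_sum_carrierI[where S = "plot_map f ` ?S"])
    show "finite (plot_map f ` ?S)" using D(3) by simp
    show "plot_sum_map f \<xi> Q = (\<lambda>_. 0)" if "Q \<notin> plot_map f ` ?S" for Q
      unfolding plot_sum_map_def using that by (intro ext sum.neutral) blast
    show "plot_sum_map f \<xi> Q i = 0" if "Q \<notin> pointed_plots E (f x)" for Q i
      unfolding plot_sum_map_def
    proof (rule sum.neutral, rule ballI)
      fix P assume "P \<in> {P. \<xi> P \<noteq> (\<lambda>_. 0) \<and> plot_map f P = Q}"
      then have "P \<notin> pointed_plots D x" using that plot_map_pointed by blast
      then show "\<xi> P i = 0" using D(2) by simp
    qed
    show "plot_sum_map f \<xi> Q i = 0" if "i \<ge> fst Q" for Q i
      unfolding plot_sum_map_def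
    proof (rule sum.neutral, rule ballI)
      fix P assume "P \<in> {P. \<xi> P \<noteq> (\<lambda>_. 0) \<and> plot_map f P = Q}"
      \<comment> \<open>Composition with \<open>f\<close> keeps the dimension of the domain, so the
        bound on coordinates at \<open>Q\<close> is also the bound at \<open>P\<close>.\<close>
      then have "i \<ge> fst P" using that fst_plot_map[of f P] by (simp del: fst_plot_map)
      then show "\<xi> P i = 0" using D(1,2) by (cases "P \<in> pointed_plots D x") simp_all
    qed
  qed
next
  fix \<xi> \<eta> assume "\<xi> \<in> carrier (plot_sum D x)" "\<eta> \<in> carrier (plot_sum D x)"
  let ?S = "{P. \<xi> P \<noteq> (\<lambda>_. 0)} \<union> {P. \<eta> P \<noteq> (\<lambda>_. 0)}"
  have S: "finite ?S"
    using \<open>\<xi> \<in> _\<close> \<open>\<eta> \<in> _\<close> by (simp add: plot_sum_carrierD(3))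
  have "plot_sum_map f (\<xi> \<oplus>\<^bsub>plot_sum D x\<^esub> \<eta>) Q i = plot_sum_map f \<xi> Q i + plot_sum_map f \<eta> Q i" for Q i
    by (subst (1 2 3) plot_sum_map_eq[OF S])
       (auto simp: plot_sum_simps simp flip: sum.distrib intro!: sum.cong)
  then show "plot_sum_map f (\<xi> \<oplus>\<^bsub>plot_sum D x\<^esub> \<eta>) =
      plot_sum_map f \<xi> \<oplus>\<^bsub>plot_sum E (f x)\<^esub> plot_sum_map f \<eta>"
    by (intro ext) (simp add: plot_sum_simps)
next
  fix r \<xi> assume "\<xi> \<in> carrier (plot_sum D x)"
  let ?S = "{P. \<xi> P \<noteq> (\<lambda>_. 0)}"
  have S: "finite ?S"
    using \<open>\<xi> \<in> _\<close> by (simp add: plot_sum_carrierD(3))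
  have "plot_sum_map f (r \<odot>\<^bsub>plot_sum D x\<^esub> \<xi>) Q i = r * plot_sum_map f \<xi> Q i" for Q i
    by (subst (1 2) plot_sum_map_eq[OF S])
       (auto simp: plot_sum_simps sum_distrib_left intro!: sum.cong)
  then show "plot_sum_map f (r \<odot>\<^bsub>plot_sum D x\<^esub> \<xi>) = r \<odot>\<^bsub>plot_sum E (f x)\<^esub> plot_sum_map f \<xi>"
    by (intro ext) (simp add: plot_sum_simps)
qed

lemma plot_sum_map_generators:
  assumes "\<xi> \<in> tangent_generators D x"
  shows "plot_sum_map f \<xi> \<in> tangent_generators E (f x)"
proof -
  obtain n U p v m W q w g where *: "\<xi> = summand_vec (n, U, p) v \<ominus>\<^bsub>plot_sum D x\<^esub> summand_vec (m, W, q) w"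
    "(n, U, p) \<in> pointed_plots D x" "(m, W, q) \<in> pointed_plots D x"
    "v \<in> topspace (Euclidean_space n)" "w \<in> topspace (Euclidean_space m)"
    "smooth_euclidean n U m W g" "p = compose U q g"
    "g (\<lambda>_. 0) = (\<lambda>_. 0)" "differential n m g (\<lambda>_. 0) v = w"
    using assms unfolding tangent_generators_def by blast
  have "plot_sum_map f \<xi> = summand_vec (n, U, compose U f p) v
      \<ominus>\<^bsub>plot_sum E (f x)\<^esub> summand_vec (m, W, compose W f q) w"
    unfolding *(1) using *(2-5) summand_vec_carrier[of "(n, U, p)"] summand_vec_carrier[of "(m, W, q)"]
    by (simp add: linear_map_minus[OF real_vector_space_plot_sum real_vector_space_plot_sum
        linear_map_plot_sum_map] plot_sum_map_summand_vec plot_map_def)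
  \<comment> \<open>\<open>compose W f q\<close> is meaningful only on \<open>W\<close>; the
    equation uses that \<open>g\<close> maps \<open>U\<close> into \<open>W\<close>.\<close>
  moreover have "compose U f p = compose U (compose W f q) g"
    using *(6,7) by (auto simp: compose_def smooth_euclidean_def Pi_iff fun_eq_iff)
  moreover have "(n, U, compose U f p) \<in> pointed_plots E (f x)" "(m, W, compose W f q) \<in> pointed_plots E (f x)"
    using plot_map_pointed[OF *(2)] plot_map_pointed[OF *(3)] by (simp_all add: plot_map_def)
  ultimately show ?thesis
    unfolding tangent_generators_def using *(4-6,8,9) by blast
qed

text \<open>The pushforward of families followed by the coset map of the target kills the
  generators. Its kernel is a subspace and therefore contains all relations, so the composite
  descends to the quotient.\<close>

lemma tangent_map_exists:
  obtains F where "F \<in> extensional (carrier (tangent_space D x))"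
    and "linear_map (tangent_space D x) (tangent_space E (f x)) F"
    and "\<And>n U p v. (n, U, p) \<in> pointed_plots D x \<Longrightarrow> v \<in> topspace (Euclidean_space n) \<Longrightarrow>
      F (tangent_class D x (n, U, p) v) = tangent_class E (f x) (n, U, compose U f p) v"
proof -
  let ?c = "\<lambda>\<xi>. tangent_relations E (f x) +>\<^bsub>plot_sum E (f x)\<^esub> \<xi>"
  let ?K = "{\<xi> \<in> carrier (plot_sum D x). ?c (plot_sum_map f \<xi>) = \<zero>\<^bsub>tangent_space E (f x)\<^esub>}"
  have lin: "linear_map (plot_sum D x) (tangent_space E (f x)) (\<lambda>\<xi>. ?c (plot_sum_map f \<xi>))"
    unfolding tangent_space_def
    by (rule linear_map_compose[OF linear_map_plot_sum_map tangent.linear_map_coset])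
  have "tangent_generators D x \<subseteq> ?K"
  proof
    fix \<xi> assume \<xi>: "\<xi> \<in> tangent_generators D x"
    then have "plot_sum_map f \<xi> \<in> tangent_relations E (f x)"
      by (intro subsetD[OF tangent_generators_subset] plot_sum_map_generators)
    then have "?c (plot_sum_map f \<xi>) = tangent_relations E (f x)"
      using tangent.a_subset by (intro tangent.V.M.a_coset_join2[OF _ tangent.a_subgroup]) auto
    moreover have "\<xi> \<in> carrier (plot_sum D x)"
      by (rule subsetD[OF tangent.a_subset subsetD[OF tangent_generators_subset \<xi>]])
    ultimately show "\<xi> \<in> ?K"
      by (simp add: tangent_space_def quotient_space_def)
  qed
  then have "tangent_relations D x \<subseteq> ?K"
    unfolding tangent_relations_eq[of D x]
    by (intro linear_span_least submodule_kernel[OF real_vector_space_plot_sum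
        real_vector_space_tangent_space lin])
  then have null: "?c (plot_sum_map f \<xi>) = \<zero>\<^bsub>tangent_space E (f x)\<^esub>"
    if "\<xi> \<in> tangent_relations D x" for \<xi>
    using that by blast
  have "\<exists>F. linear_map (tangent_space D x) (tangent_space E (f x)) F \<and>
      (\<forall>\<xi>\<in>carrier (plot_sum D x).
        F (tangent_relations D x +>\<^bsub>plot_sum D x\<^esub> \<xi>) = ?c (plot_sum_map f \<xi>))"
    unfolding tangent_space_def[of D x]
    by (rule tangent.linear_map_quotient_lift[OF real_vector_space_tangent_space lin]) (rule null)
  then obtain F where F: "linear_map (tangent_space D x) (tangent_space E (f x)) F"
    "\<forall>\<xi>\<in>carrier (plot_sum D x).
      F (tangent_relations D x +>\<^bsub>plot_sum D x\<^esub> \<xi>) = ?c (plot_sum_map f \<xi>)"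
    by (elim exE conjE)
  show thesis
  \<comment> \<open>\<open>tangent_map\<close> asks for an extensional function, so the arbitrary
    values of \<open>F\<close> off the carrier are replaced by \<open>undefined\<close>.\<close>
  proof (rule that[of "restrict F (carrier (tangent_space D x))"])
    show "linear_map (tangent_space D x) (tangent_space E (f x)) (restrict F (carrier (tangent_space D x)))"
      by (rule linear_map_restrict[OF real_vector_space_tangent_space F(1)])
    fix n U p v assume p: "(n, U, p) \<in> pointed_plots D x" and v: "v \<in> topspace (Euclidean_space n)"
    then show "restrict F (carrier (tangent_space D x)) (tangent_class D x (n, U, p) v) =
        tangent_class E (f x) (n, U, compose U f p) v"
      using tangent_class_carrier[of "(n, U, p)" D x v] summand_vec_carrier[of "(n, U, p)" D x v]
      by (simp add: tangent_class_def F(2) plot_sum_map_summand_vec plot_map_def)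
  qed simp
qed

text \<open>Discharges the definite description. Two candidates agree on the classes [p, v], hence
  on the carrier, and extensionality turns this into equality of functions.\<close>

lemma
  shows tangent_map_extensional: "tangent_map D x E f \<in> extensional (carrier (tangent_space D x))"
    and linear_map_tangent_map:
      "linear_map (tangent_space D x) (tangent_space E (f x)) (tangent_map D x E f)"
    and tangent_map_class: "(n, U, p) \<in> pointed_plots D x \<Longrightarrow> v \<in> topspace (Euclidean_space n) \<Longrightarrow>
      tangent_map D x E f (tangent_class D x (n, U, p) v) =
      tangent_class E (f x) (n, U, compose U f p) v"
proof -
  let ?P = "\<lambda>F. F \<in> extensional (carrier (tangent_space D x)) \<and>
      linear_map (tangent_space D x) (tangent_space E (f x)) F \<and>
      (\<forall>n U p v. (n, U, p) \<in> pointed_plots D x \<and> v \<in> topspace (Euclidean_space n) \<longrightarrow>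
         F (tangent_class D x (n, U, p) v) = tangent_class E (f x) (n, U, compose U f p) v)"
  have "\<exists>F. ?P F"
    by (rule tangent_map_exists[of x]) blast
  moreover have "F = G" if F: "?P F" and G: "?P G" for F G
  proof (rule extensionalityI)
    show "F \<in> extensional (carrier (tangent_space D x))" using F by blast
    show "G \<in> extensional (carrier (tangent_space D x))" using G by blast
    fix t assume t: "t \<in> carrier (tangent_space D x)"
    moreover have "F (tangent_class D x (n, U, p) v) = G (tangent_class D x (n, U, p) v)"
      if "(n, U, p) \<in> pointed_plots D x" "v \<in> topspace (Euclidean_space n)" for n U p v
      using F G that by simp
    ultimately show "F t = G t"
      using F G tangent_space_linear_eqI[OF real_vector_space_tangent_space, of D x E "f x" F G t]
      by simp
  qed
  ultimately have "\<exists>!F. ?P F" by (rule ex_ex1I)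
  from theI'[OF this] have "?P (tangent_map D x E f)"
    unfolding tangent_map_def .
  then show "tangent_map D x E f \<in> extensional (carrier (tangent_space D x))"
    "linear_map (tangent_space D x) (tangent_space E (f x)) (tangent_map D x E f)"
    "(n, U, p) \<in> pointed_plots D x \<Longrightarrow> v \<in> topspace (Euclidean_space n) \<Longrightarrow>
      tangent_map D x E f (tangent_class D x (n, U, p) v) =
      tangent_class E (f x) (n, U, compose U f p) v"
    by auto
qed

end

text \<open>Only the values of \<open>f\<close> on \<open>X\<close> are prescribed, since the
  neutral element of a group acts as the identity restricted to \<open>X\<close>. Plots take values
  in \<open>X\<close>, so composing them with \<open>f\<close> changes nothing.\<close>

lemma tangent_map_id:
  assumes D: "diffeology X D" and x: "x \<in> X" and f: "smooth_map X D X D f"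
    and id: "\<And>y. y \<in> X \<Longrightarrow> f y = y" and t: "t \<in> carrier (tangent_space D x)"
  shows "tangent_map D x D f t = t"
proof -
  have "tangent_map D x D f t = (\<lambda>t. t) t"
  proof (rule tangent_space_linear_eqI[OF real_vector_space_tangent_space _ _ _ t])
    show "linear_map (tangent_space D x) (tangent_space D x) (tangent_map D x D f)"
      using linear_map_tangent_map[OF f, of x] id[OF x] by simp
    show "linear_map (tangent_space D x) (tangent_space D x) (\<lambda>t. t)"
      by (simp add: linear_map_def)
    fix n U p v assume p: "(n, U, p) \<in> pointed_plots D x" and v: "v \<in> topspace (Euclidean_space n)"
    have pD: "(n, U, p) \<in> D" using p by (simp add: pointed_plots_def)
    have "compose U f p = p"
    proof (rule extensionalityI)
      show "compose U f p \<in> extensional U" by (rule compose_extensional)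
      show "p \<in> extensional U" using plot_PiE[OF D pD] by (simp add: PiE_def)
      show "compose U f p u = p u" if "u \<in> U" for u
        using plot_in_space[OF D pD that] that by (simp add: compose_eq id)
    qed
    then show "tangent_map D x D f (tangent_class D x (n, U, p) v) = tangent_class D x (n, U, p) v"
      using tangent_map_class[OF f p v] id[OF x] by simp
  qed
  then show ?thesis by simp
qed

text \<open>The composite is a separate function \<open>h\<close> that agrees with \<open>g\<close>
  after \<open>f\<close> on \<open>X\<close> alone. This covers the action of a product of group
  elements as well as the equation saying that pi after \<open>\<phi> h\<close> is pi.\<close>

lemma tangent_map_compose:
  assumes D: "diffeology X D" and f: "smooth_map X D Y E f" and g: "smooth_map Y E Z F g"
    and h: "smooth_map X D Z F h" and x: "x \<in> X" and eq: "\<And>y. y \<in> X \<Longrightarrow> h y = g (f y)"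
    and t: "t \<in> carrier (tangent_space D x)"
  shows "tangent_map D x F h t = tangent_map E (f x) F g (tangent_map D x E f t)"
proof (rule tangent_space_linear_eqI[OF real_vector_space_tangent_space _ _ _ t])
  show "linear_map (tangent_space D x) (tangent_space F (h x)) (tangent_map D x F h)"
    by (rule linear_map_tangent_map[OF h])
  show "linear_map (tangent_space D x) (tangent_space F (h x))
      (\<lambda>t. tangent_map E (f x) F g (tangent_map D x E f t))"
    \<comment> \<open>The target tangent space is indexed by its base point, so \<open>h x\<close>
      has to become \<open>g (f x)\<close> before the types of the two linear maps match as vector
      spaces.\<close>
    unfolding eq[OF x]
    by (rule linear_map_compose[OF linear_map_tangent_map[OF f] linear_map_tangent_map[OF g]])
  fix n U p v assume p: "(n, U, p) \<in> pointed_plots D x" and v: "v \<in> topspace (Euclidean_space n)"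
  have "(n, U, compose U f p) \<in> pointed_plots E (f x)"
    using plot_map_pointed[OF f p] by (simp add: plot_map_def)
  moreover have "compose U h p = compose U g (compose U f p)"
    using eq plot_in_space[OF D, of n U p] p by (auto simp: compose_def fun_eq_iff pointed_plots_def)
  ultimately show "tangent_map D x F h (tangent_class D x (n, U, p) v) =
      tangent_map E (f x) F g (tangent_map D x E f (tangent_class D x (n, U, p) v))"
    using p v by (simp add: tangent_map_class[OF h] tangent_map_class[OF f] tangent_map_class[OF g] eq[OF x])
qed

lemma
  assumes "t \<in> carrier (tangent_space D x)"
  shows tangent_add_closed:
      "s \<in> carrier (tangent_space D x) \<Longrightarrow> s \<oplus>\<^bsub>tangent_space D x\<^esub> t \<in> carrier (tangent_space D x)"
    and tangent_smult_closed: "r \<odot>\<^bsub>tangent_space D x\<^esub> t \<in> carrier (tangent_space D x)"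
proof -
  interpret module real_ring "tangent_space D x" by (rule real_vector_space_tangent_space)
  show "s \<in> carrier (tangent_space D x) \<Longrightarrow> s \<oplus>\<^bsub>tangent_space D x\<^esub> t \<in> carrier (tangent_space D x)"
    using assms by simp
  show "r \<odot>\<^bsub>tangent_space D x\<^esub> t \<in> carrier (tangent_space D x)"
    using assms smult_closed[of r t] by simp
qed

lemma tangent_zero_closed: "\<zero>\<^bsub>tangent_space D x\<^esub> \<in> carrier (tangent_space D x)"
proof -
  interpret module real_ring "tangent_space D x" by (rule real_vector_space_tangent_space)
  show ?thesis by simp
qed

lemma tangent_bundle_iff: "s \<in> tangent_bundle X D \<longleftrightarrow> fst s \<in> X \<and> snd s \<in> carrier (tangent_space D (fst s))"
  by (cases s) (simp add: tangent_bundle_def)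

section \<open>The tangent bundle\<close>

text \<open>Unwinds product diffeologies and subdiffeologies once and for all: admissibility becomes
  a list of closure properties of plots, which can be checked for a pullback without handling plots
  of pairs.\<close>

lemma smooth_bundle_operations_iff:
  assumes E: "diffeology (tangent_bundle X D) E"
  shows "smooth_bundle_operations X D E \<longleftrightarrow>
    (\<forall>n U p. (n, U, p) \<in> E \<longrightarrow> (n, U, \<lambda>u\<in>U. fst (p u)) \<in> D) \<and>
    (\<forall>n U s t. (n, U, s) \<in> E \<and> (n, U, t) \<in> E \<and> (\<forall>u\<in>U. fst (s u) = fst (t u)) \<longrightarrow>
       (n, U, \<lambda>u\<in>U. (fst (s u), snd (s u) \<oplus>\<^bsub>tangent_space D (fst (s u))\<^esub> snd (t u))) \<in> E) \<and>
    (\<forall>n U r t. (n, U, r) \<in> real_diffeology \<and> (n, U, t) \<in> E \<longrightarrow>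
       (n, U, \<lambda>u\<in>U. (fst (t u), r u \<odot>\<^bsub>tangent_space D (fst (t u))\<^esub> snd (t u))) \<in> E) \<and>
    (\<forall>n U p. (n, U, p) \<in> D \<longrightarrow> (n, U, \<lambda>u\<in>U. (p u, \<zero>\<^bsub>tangent_space D (p u)\<^esub>)) \<in> E)"
    (is "_ \<longleftrightarrow> ?proj \<and> ?add \<and> ?smult \<and> ?zero")
proof -
  let ?B = "tangent_bundle X D"
  have "smooth_map ?B E X D fst \<longleftrightarrow> ?proj"
    by (auto simp: smooth_map_def compose_def tangent_bundle_iff)
  moreover have "smooth_map (fibre_product ?B)
      (subdiffeology (product_diffeology E E) (fibre_product ?B)) ?B E
      (\<lambda>(s, t). (fst s, snd s \<oplus>\<^bsub>tangent_space D (fst s)\<^esub> snd t)) \<longleftrightarrow> ?add"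
    (is "smooth_map _ ?P _ _ ?a \<longleftrightarrow> _")
  proof
    assume smooth: "smooth_map (fibre_product ?B) ?P ?B E ?a"
    show ?add
    proof (intro allI impI; elim conjE)
      fix n U s t
      assume s: "(n, U, s) \<in> E" and t: "(n, U, t) \<in> E" and st: "\<forall>u\<in>U. fst (s u) = fst (t u)"
      let ?p = "\<lambda>u\<in>U. (s u, t u)"
      have "(n, U, ?p) \<in> product_diffeology E E"
        by (rule product_plotI[OF s t plot_extensional[OF E s] plot_extensional[OF E t]])
      moreover have "?p \<in> U \<rightarrow> fibre_product ?B"
        using st plot_in_space[OF E s] plot_in_space[OF E t] by (simp add: fibre_product_def)
      ultimately have "(n, U, compose U ?a ?p) \<in> E"
        using smooth by (simp add: smooth_map_def subdiffeology_def)
      moreover have "compose U ?a ?p =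
          (\<lambda>u\<in>U. (fst (s u), snd (s u) \<oplus>\<^bsub>tangent_space D (fst (s u))\<^esub> snd (t u)))"
        by (rule extensionalityI[of _ U]) (simp_all add: compose_def)
      ultimately show "(n, U, \<lambda>u\<in>U. (fst (s u), snd (s u) \<oplus>\<^bsub>tangent_space D (fst (s u))\<^esub> snd (t u))) \<in> E"
        by simp
    qed
  next
    assume add: ?add
    have "(n, U, compose U ?a p) \<in> E" if p: "(n, U, p) \<in> ?P" for n U p
    proof -
      have p': "(n, U, p) \<in> product_diffeology E E" "p \<in> U \<rightarrow> fibre_product ?B"
        using p by (simp_all add: subdiffeology_def)
      have fib: "fst (fst (p u)) = fst (snd (p u))" if "u \<in> U" for u
        using p'(2) that by (auto simp: fibre_product_def Pi_iff split_beta)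
      \<comment> \<open>The repeated restrictions instantiate \<open>?add\<close> literally with the
        two components of \<open>p\<close>; the equation after it removes them.\<close>
      have "(n, U, \<lambda>u\<in>U. (fst ((\<lambda>u\<in>U. fst (p u)) u), snd ((\<lambda>u\<in>U. fst (p u)) u)
          \<oplus>\<^bsub>tangent_space D (fst ((\<lambda>u\<in>U. fst (p u)) u))\<^esub> snd ((\<lambda>u\<in>U. snd (p u)) u))) \<in> E"
        using product_plotD(1,2)[OF p'(1)] fib
        by (intro add[rule_format] conjI ballI) (assumption | simp)+
      moreover have "(\<lambda>u\<in>U. (fst ((\<lambda>u\<in>U. fst (p u)) u), snd ((\<lambda>u\<in>U. fst (p u)) u)
          \<oplus>\<^bsub>tangent_space D (fst ((\<lambda>u\<in>U. fst (p u)) u))\<^esub> snd ((\<lambda>u\<in>U. snd (p u)) u))) = compose U ?a p"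
        by (rule extensionalityI[of _ U]) (simp_all add: compose_def split_beta)
      ultimately show ?thesis by simp
    qed
    moreover have "?a \<in> fibre_product ?B \<rightarrow> ?B"
      by (auto simp: fibre_product_def tangent_bundle_iff intro: tangent_add_closed)
    ultimately show "smooth_map (fibre_product ?B) ?P ?B E ?a" by (simp add: smooth_map_def)
  qed
  moreover have "smooth_map (UNIV \<times> ?B) (product_diffeology real_diffeology E) ?B E
      (\<lambda>(r, t). (fst t, r \<odot>\<^bsub>tangent_space D (fst t)\<^esub> snd t)) \<longleftrightarrow> ?smult"
    (is "smooth_map _ ?P _ _ ?a \<longleftrightarrow> _")
  proof
    assume smooth: "smooth_map (UNIV \<times> ?B) ?P ?B E ?a"
    show ?smult
    proof (intro allI impI; elim conjE)
      fix n U r t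
      assume r: "(n, U, r) \<in> real_diffeology" and t: "(n, U, t) \<in> E"
      let ?p = "\<lambda>u\<in>U. (r u, t u)"
      have "(n, U, ?p) \<in> ?P"
        by (rule product_plotI[OF r t real_plot_extensional[OF r] plot_extensional[OF E t]])
      then have "(n, U, compose U ?a ?p) \<in> E"
        using smooth by (simp add: smooth_map_def)
      moreover have "compose U ?a ?p = (\<lambda>u\<in>U. (fst (t u), r u \<odot>\<^bsub>tangent_space D (fst (t u))\<^esub> snd (t u)))"
        by (rule extensionalityI[of _ U]) (simp_all add: compose_def)
      ultimately show "(n, U, \<lambda>u\<in>U. (fst (t u), r u \<odot>\<^bsub>tangent_space D (fst (t u))\<^esub> snd (t u))) \<in> E"
        by simp
    qed
  next
    assume smult: ?smult
    have "(n, U, compose U ?a p) \<in> E" if p: "(n, U, p) \<in> ?P" for n U p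
    proof -
      have "(n, U, \<lambda>u\<in>U. (fst ((\<lambda>u\<in>U. snd (p u)) u), (\<lambda>u\<in>U. fst (p u)) u
          \<odot>\<^bsub>tangent_space D (fst ((\<lambda>u\<in>U. snd (p u)) u))\<^esub> snd ((\<lambda>u\<in>U. snd (p u)) u))) \<in> E"
        using product_plotD[OF p] by (intro smult[rule_format] conjI)
      moreover have "(\<lambda>u\<in>U. (fst ((\<lambda>u\<in>U. snd (p u)) u), (\<lambda>u\<in>U. fst (p u)) u
          \<odot>\<^bsub>tangent_space D (fst ((\<lambda>u\<in>U. snd (p u)) u))\<^esub> snd ((\<lambda>u\<in>U. snd (p u)) u))) = compose U ?a p"
        by (rule extensionalityI[of _ U]) (simp_all add: compose_def split_beta)
      ultimately show ?thesis by simp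
    qed
    moreover have "?a \<in> UNIV \<times> ?B \<rightarrow> ?B"
      by (auto simp: tangent_bundle_iff intro: tangent_smult_closed)
    ultimately show "smooth_map (UNIV \<times> ?B) ?P ?B E ?a" by (simp add: smooth_map_def)
  qed
  moreover have "smooth_map X D ?B E (\<lambda>x. (x, \<zero>\<^bsub>tangent_space D x\<^esub>)) \<longleftrightarrow> ?zero"
    by (simp add: smooth_map_def compose_def tangent_bundle_iff tangent_zero_closed)
  ultimately show ?thesis
    unfolding smooth_bundle_operations_def Let_def by simp
qed

definition bundle_diffeologies ::
  "'a set \<Rightarrow> 'a param set \<Rightarrow> ('a \<times> ('a param \<Rightarrow> nat \<Rightarrow> real) set) param set set" where
  "bundle_diffeologies X D =
     {E. diffeology (tangent_bundle X D) E \<and> bundle_param D ` D \<subseteq> E \<and> smooth_bundle_operations X D E}"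

text \<open>A diffeology contains the generated diffeology exactly when it contains the generating
  family, so the inner generation step can be replaced by a condition on the maps
  \<open>bundle_param\<close>.\<close>

lemma tangent_bundle_diffeology_eq: "tangent_bundle_diffeology X D = \<Inter>(bundle_diffeologies X D)"
proof -
  have "generated_diffeology B F \<subseteq> E \<longleftrightarrow> F \<subseteq> E" if "diffeology B E" for B and F E :: "'c param set"
    using that unfolding generated_diffeology_def by blast
  then show ?thesis
    unfolding tangent_bundle_diffeology_def bundle_diffeologies_def by (metis (no_types, lifting))
qed

context
  fixes X :: "'a set" and D :: "'a param set" and E
  assumes E: "E \<in> bundle_diffeologies X D"
begin

lemma bundle_diffeology: "diffeology (tangent_bundle X D) E"
  and bundle_param_mem: "P \<in> D \<Longrightarrow> bundle_param D P \<in> E"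
  using E by (auto simp: bundle_diffeologies_def)

lemma
  shows bundle_proj: "(n, U, p) \<in> E \<Longrightarrow> (n, U, \<lambda>u\<in>U. fst (p u)) \<in> D"
    and bundle_add: "(n, U, s) \<in> E \<Longrightarrow> (n, U, t) \<in> E \<Longrightarrow> (\<And>u. u \<in> U \<Longrightarrow> fst (s u) = fst (t u)) \<Longrightarrow>
       (n, U, \<lambda>u\<in>U. (fst (s u), snd (s u) \<oplus>\<^bsub>tangent_space D (fst (s u))\<^esub> snd (t u))) \<in> E"
    and bundle_smult: "(n, U, r) \<in> real_diffeology \<Longrightarrow> (n, U, t) \<in> E \<Longrightarrow>
       (n, U, \<lambda>u\<in>U. (fst (t u), r u \<odot>\<^bsub>tangent_space D (fst (t u))\<^esub> snd (t u))) \<in> E"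
    and bundle_zero: "(n, U, q) \<in> D \<Longrightarrow> (n, U, \<lambda>u\<in>U. (q u, \<zero>\<^bsub>tangent_space D (q u)\<^esub>)) \<in> E"
  using E smooth_bundle_operations_iff[OF bundle_diffeology]
  by (simp_all add: bundle_diffeologies_def)

end

section \<open>The map TX \<rightarrow> TY over f and pullback of admissible diffeologies\<close>

definition bundle_map ::
  "'a param set \<Rightarrow> 'b param set \<Rightarrow> ('a \<Rightarrow> 'b) \<Rightarrow>
   'a \<times> ('a param \<Rightarrow> nat \<Rightarrow> real) set \<Rightarrow> 'b \<times> ('b param \<Rightarrow> nat \<Rightarrow> real) set" where
  "bundle_map D E f s = (f (fst s), tangent_map D (fst s) E f (snd s))"

lemma bundle_map_in_bundle:
  assumes f: "smooth_map X D Y E f" and s: "s \<in> tangent_bundle X D"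
  shows "bundle_map D E f s \<in> tangent_bundle Y E"
proof -
  have "tangent_map D (fst s) E f (snd s) \<in> carrier (tangent_space E (f (fst s)))"
    using s by (intro linear_map_carrier[OF linear_map_tangent_map[OF f]]) (simp add: tangent_bundle_iff)
  moreover have "f (fst s) \<in> Y"
    using f s by (auto simp: tangent_bundle_iff smooth_map_def)
  ultimately show ?thesis by (simp add: tangent_bundle_iff bundle_map_def)
qed

lemma vector_part_topspace: "vector_part n w \<in> topspace (Euclidean_space n)"
  by (simp add: vector_part_def topspace_Euclidean_space)

lemma base_part_in: "w \<in> tangent_open n U \<Longrightarrow> base_part n w \<in> U"
  by (simp add: tangent_open_def)

lemma bundle_param_eq:
  "bundle_param D (n, U, p) = (2 * n, tangent_open n U, \<lambda>w\<in>tangent_open n U.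
     (p (base_part n w), tangent_class D (p (base_part n w)) (translate (base_part n w) (n, U, p))
        (vector_part n w)))"
  by (simp add: bundle_param_def Let_def)

lemma bundle_param_parametrization:
  assumes D: "diffeology X D" and P: "P \<in> D"
  shows "bundle_param D P \<in> parametrizations (tangent_bundle X D)"
proof -
  obtain n U p where P_eq: "P = (n, U, p)" by (cases P)
  have p: "(n, U, p) \<in> D" using P P_eq by simp
  have "tangent_class D (p u) (translate u (n, U, p)) (vector_part n w) \<in> carrier (tangent_space D (p u))"
    if "u \<in> U" for u w
    using plot_translate[OF D p that] vector_part_topspace[of n w]
    by (intro tangent_class_carrier) (simp_all add: translate_eq)
  then show ?thesis
    using openin_tangent_open[OF plot_openin[OF D p]] base_part_in plot_in_space[OF D p]
    by (auto simp: P_eq bundle_param_eq parametrizations_def tangent_bundle_iff)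
qed

text \<open>Translating a plot commutes with composing it with \<open>f\<close>. Hence the
  generators of the diffeology of TX are sent to those of TY, which puts them in the
  pullback.\<close>

lemma bundle_param_natural:
  assumes D: "diffeology X D" and f: "smooth_map X D Y E f" and p: "(n, U, p) \<in> D"
  shows "compose (tangent_open n U) (bundle_map D E f) (snd (snd (bundle_param D (n, U, p)))) =
    snd (snd (bundle_param E (n, U, compose U f p)))"
proof (rule extensionalityI[of _ "tangent_open n U"])
  fix w assume w: "w \<in> tangent_open n U"
  let ?u = "base_part n w"
  have u: "?u \<in> U" using w by (rule base_part_in)
  have "(n, translated_domain n U ?u, \<lambda>y\<in>translated_domain n U ?u. p (\<lambda>i. y i + ?u i))
      \<in> pointed_plots D (p ?u)"
    using plot_translate[OF D p u] by (simp add: translate_eq)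
  from tangent_map_class[OF f this vector_part_topspace]
  have "tangent_map D (p ?u) E f (tangent_class D (p ?u) (translate ?u (n, U, p)) (vector_part n w)) =
      tangent_class E (f (p ?u)) (n, translated_domain n U ?u, compose (translated_domain n U ?u) f
        (\<lambda>y\<in>translated_domain n U ?u. p (\<lambda>i. y i + ?u i))) (vector_part n w)"
    by (simp add: translate_eq)
  moreover have "(n, translated_domain n U ?u, compose (translated_domain n U ?u) f
        (\<lambda>y\<in>translated_domain n U ?u. p (\<lambda>i. y i + ?u i))) = translate ?u (n, U, compose U f p)"
    unfolding translate_eq
    by (intro arg_cong2[where f = Pair] refl extensionalityI[of _ "translated_domain n U ?u"])
       (simp_all add: compose_def translated_domain_def)
  ultimately show "compose (tangent_open n U) (bundle_map D E f) (snd (snd (bundle_param D (n, U, p)))) w =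
      snd (snd (bundle_param E (n, U, compose U f p))) w"
    using w u by (simp add: bundle_param_eq compose_eq bundle_map_def)
qed (simp_all add: bundle_param_eq)

text \<open>\<open>bundle_map\<close> covers \<open>f\<close> and is linear on fibres, so it
  commutes with all bundle operations. Each closure property then splits into one of \<E> and a
  statement about base points in \<open>D\<close>.\<close>

lemma pullback_bundle_diffeology:
  assumes D: "diffeology X D" and f: "smooth_map X D Y E f"
    and \<E>: "\<E> \<in> bundle_diffeologies Y E"
  shows "parametrizations (tangent_bundle X D) \<inter>
    \<Inter>{pullback_diffeology (tangent_bundle X D) fst D,
      pullback_diffeology (tangent_bundle X D) (bundle_map D E f) \<E>} \<in> bundle_diffeologies X D"
    (is "?\<F> \<in> _")
proof -
  define \<F> where "\<F> = ?\<F>"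
  let ?B = "tangent_bundle X D"
  let ?b = "bundle_map D E f"
  note lin = linear_map_tangent_map[OF f]
  have \<F>: "diffeology ?B \<F>"
    unfolding \<F>_def
  proof (rule diffeology_Inter)
    have "fst \<in> ?B \<rightarrow> X" "?b \<in> ?B \<rightarrow> tangent_bundle Y E"
      using bundle_map_in_bundle[OF f] by (auto simp: tangent_bundle_iff)
    then show "diffeology ?B G"
      if "G \<in> {pullback_diffeology ?B fst D, pullback_diffeology ?B ?b \<E>}" for G
      using that diffeology_pullback[OF D, of fst] diffeology_pullback[OF bundle_diffeology[OF \<E>], of ?b]
      by auto
  qed
  have mem: "(n, U, p) \<in> \<F> \<longleftrightarrow> (n, U, p) \<in> parametrizations ?B \<and>
      (n, U, \<lambda>u\<in>U. fst (p u)) \<in> D \<and> (n, U, \<lambda>u\<in>U. ?b (p u)) \<in> \<E>" for n U p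
    by (auto simp: \<F>_def pullback_diffeology_def compose_def)
  have mem_params: "(n, U, p) \<in> parametrizations ?B \<longleftrightarrow>
      openin (Euclidean_space n) U \<and> p \<in> U \<rightarrow>\<^sub>E ?B" for n U p
    by (simp add: parametrizations_def)
  have in_B: "fst (p u) \<in> X" "snd (p u) \<in> carrier (tangent_space D (fst (p u)))"
    if "(n, U, p) \<in> \<F>" "u \<in> U" for n U p u
    using plot_in_space[OF \<F> that] by (simp_all add: tangent_bundle_iff)
  have params: "bundle_param D ` D \<subseteq> \<F>"
  proof
    fix Q assume "Q \<in> bundle_param D ` D"
    then obtain n U p where p: "(n, U, p) \<in> D" and Q: "Q = bundle_param D (n, U, p)" by auto
    let ?q = "snd (snd Q)"
    have Q': "Q = (2 * n, tangent_open n U, ?q)" by (simp add: Q bundle_param_eq)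
    \<comment> \<open>On base points the induced map is \<open>p\<close> after the smooth projection
      \<open>base_part n\<close>, hence a plot of \<open>D\<close>.\<close>
    have "(2 * n, tangent_open n U, compose (tangent_open n U) p (base_part n)) \<in> D"
      using openin_tangent_open[OF plot_openin[OF D p]] smooth_euclidean_base_part
      by (rule plot_compose[OF D p])
    moreover have "compose (tangent_open n U) p (base_part n) = (\<lambda>w\<in>tangent_open n U. fst (?q w))"
      by (rule extensionalityI[of _ "tangent_open n U"]) (simp_all add: Q bundle_param_eq compose_def)
    moreover have "bundle_param E (n, U, compose U f p) \<in> \<E>"
      using f p by (intro bundle_param_mem[OF \<E>]) (simp add: smooth_map_def)
    moreover have "bundle_param E (n, U, compose U f p) =
        (2 * n, tangent_open n U, \<lambda>w\<in>tangent_open n U. ?b (?q w))"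
      using bundle_param_natural[OF D f p] by (simp add: Q compose_def) (simp add: bundle_param_eq)
    moreover have "Q \<in> parametrizations ?B"
      using bundle_param_parametrization[OF D p] Q by simp
    ultimately show "Q \<in> \<F>" using Q' mem by metis
  qed
  have proj: "(n, U, \<lambda>u\<in>U. fst (p u)) \<in> D" if "(n, U, p) \<in> \<F>" for n U p
    using that mem by blast
  have add: "(n, U, \<lambda>u\<in>U. (fst (s u), snd (s u) \<oplus>\<^bsub>tangent_space D (fst (s u))\<^esub> snd (t u))) \<in> \<F>"
    if s: "(n, U, s) \<in> \<F>" and t: "(n, U, t) \<in> \<F>" and st: "\<And>u. u \<in> U \<Longrightarrow> fst (s u) = fst (t u)"
    for n U s t
  proof -
    let ?a = "\<lambda>u\<in>U. (fst (s u), snd (s u) \<oplus>\<^bsub>tangent_space D (fst (s u))\<^esub> snd (t u))"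
    let ?s = "\<lambda>u\<in>U. ?b (s u)" and ?t = "\<lambda>u\<in>U. ?b (t u)"
    have sB: "fst (s u) \<in> X" "snd (s u) \<in> carrier (tangent_space D (fst (s u)))"
      "snd (t u) \<in> carrier (tangent_space D (fst (s u)))" if "u \<in> U" for u
      using in_B[OF s that] in_B[OF t that] st[OF that] by simp_all
    have "?a \<in> U \<rightarrow>\<^sub>E ?B"
      using sB by (simp add: PiE_def Pi_iff tangent_bundle_iff tangent_add_closed)
    moreover have "(\<lambda>u\<in>U. fst (?a u)) = (\<lambda>u\<in>U. fst (s u))"
      by (rule extensionalityI[of _ U]) simp_all
    moreover have "(n, U, \<lambda>u\<in>U. (fst (?s u), snd (?s u) \<oplus>\<^bsub>tangent_space E (fst (?s u))\<^esub> snd (?t u))) \<in> \<E>"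
    proof (rule bundle_add[OF \<E>])
      show "(n, U, ?s) \<in> \<E>" using s mem by blast
      show "(n, U, ?t) \<in> \<E>" using t mem by blast
    qed (simp add: bundle_map_def st)
    \<comment> \<open>Additivity of the fibre map applies because \<open>s u\<close> and
      \<open>t u\<close> lie over the same point.\<close>
    moreover have "(\<lambda>u\<in>U. (fst (?s u), snd (?s u) \<oplus>\<^bsub>tangent_space E (fst (?s u))\<^esub> snd (?t u))) =
        (\<lambda>u\<in>U. ?b (?a u))"
      using sB st by (intro extensionalityI[of _ U]) (simp_all add: bundle_map_def linear_map_add[OF lin])
    ultimately show ?thesis
      using s by (simp add: mem mem_params)
  qed
  have smult: "(n, U, \<lambda>u\<in>U. (fst (t u), r u \<odot>\<^bsub>tangent_space D (fst (t u))\<^esub> snd (t u))) \<in> \<F>"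
    if r: "(n, U, r) \<in> real_diffeology" and t: "(n, U, t) \<in> \<F>" for n U r t
  proof -
    let ?a = "\<lambda>u\<in>U. (fst (t u), r u \<odot>\<^bsub>tangent_space D (fst (t u))\<^esub> snd (t u))"
    let ?t = "\<lambda>u\<in>U. ?b (t u)"
    note tB = in_B[OF t]
    have "?a \<in> U \<rightarrow>\<^sub>E ?B"
      using tB by (simp add: PiE_def Pi_iff tangent_bundle_iff tangent_smult_closed)
    moreover have "(\<lambda>u\<in>U. fst (?a u)) = (\<lambda>u\<in>U. fst (t u))"
      by (rule extensionalityI[of _ U]) simp_all
    moreover have "(n, U, \<lambda>u\<in>U. (fst (?t u), r u \<odot>\<^bsub>tangent_space E (fst (?t u))\<^esub> snd (?t u))) \<in> \<E>"
    proof (rule bundle_smult[OF \<E> r])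
      show "(n, U, ?t) \<in> \<E>" using t mem by blast
    qed
    moreover have "(\<lambda>u\<in>U. (fst (?t u), r u \<odot>\<^bsub>tangent_space E (fst (?t u))\<^esub> snd (?t u))) = (\<lambda>u\<in>U. ?b (?a u))"
      using tB by (intro extensionalityI[of _ U]) (simp_all add: bundle_map_def linear_map_smult[OF lin])
    ultimately show ?thesis
      using t by (simp add: mem mem_params)
  qed
  have zero: "(n, U, \<lambda>u\<in>U. (p u, \<zero>\<^bsub>tangent_space D (p u)\<^esub>)) \<in> \<F>" if p: "(n, U, p) \<in> D" for n U p
  proof -
    let ?a = "\<lambda>u\<in>U. (p u, \<zero>\<^bsub>tangent_space D (p u)\<^esub>)"
    let ?p = "compose U f p"
    have "?a \<in> U \<rightarrow>\<^sub>E ?B"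
      using plot_in_space[OF D p] by (simp add: PiE_def Pi_iff tangent_bundle_iff tangent_zero_closed)
    moreover have "(\<lambda>u\<in>U. fst (?a u)) = p"
      using plot_extensional[OF D p] by (intro extensionalityI[of _ U]) simp_all
    moreover have "(n, U, \<lambda>u\<in>U. (?p u, \<zero>\<^bsub>tangent_space E (?p u)\<^esub>)) \<in> \<E>"
      using f p by (intro bundle_zero[OF \<E>]) (simp add: smooth_map_def)
    moreover have "(\<lambda>u\<in>U. (?p u, \<zero>\<^bsub>tangent_space E (?p u)\<^esub>)) = (\<lambda>u\<in>U. ?b (?a u))"
      by (intro extensionalityI[of _ U]) (simp_all add: compose_eq bundle_map_def
          linear_map_zero[OF real_vector_space_tangent_space real_vector_space_tangent_space lin])
    ultimately show ?thesis
      using p plot_openin[OF D p] by (simp add: mem mem_params)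
  qed
  have "smooth_bundle_operations X D \<F>"
    unfolding smooth_bundle_operations_iff[OF \<F>]
    by (intro conjI allI impI; (elim conjE)?; rule proj add smult zero; (assumption | simp))
  then show ?thesis
    unfolding bundle_diffeologies_def using \<F> params by (simp only: \<F>_def[symmetric] mem_Collect_eq simp_thms)
qed

section \<open>The diffeology of a single tangent space\<close>

lemma tangent_diffeology_iff:
  "(n, U, p) \<in> tangent_diffeology X D x \<longleftrightarrow>
    openin (Euclidean_space n) U \<and> p \<in> U \<rightarrow>\<^sub>E carrier (tangent_space D x) \<and>
    (\<forall>E\<in>bundle_diffeologies X D. (n, U, \<lambda>u\<in>U. (x, p u)) \<in> E)"
  by (auto simp: tangent_diffeology_def tangent_bundle_diffeology_eq parametrizations_def)

text \<open>The fibre carries the intersection of the pullbacks, along the inclusion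
  \<open>Pair x\<close>, of all admissible diffeologies of the bundle.\<close>

lemma diffeology_tangent_diffeology:
  assumes x: "x \<in> X"
  shows "diffeology (carrier (tangent_space D x)) (tangent_diffeology X D x)"
proof -
  let ?T = "carrier (tangent_space D x)"
  have "tangent_diffeology X D x =
      parametrizations ?T \<inter> \<Inter>(pullback_diffeology ?T (Pair x) ` bundle_diffeologies X D)"
    by (auto simp: tangent_diffeology_def tangent_bundle_diffeology_eq pullback_diffeology_def compose_def)
  moreover have "Pair x \<in> ?T \<rightarrow> tangent_bundle X D"
    using x by (auto simp: tangent_bundle_iff)
  ultimately show ?thesis
    by (auto intro!: diffeology_Inter diffeology_pullback bundle_diffeology)
qed

lemma smooth_linear_map_tangent_map:
  assumes D: "diffeology X D" and f: "smooth_map X D Y E f"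
  shows "smooth_linear_map (tangent_space D x) (tangent_diffeology X D x)
    (tangent_space E (f x)) (tangent_diffeology Y E (f x)) (tangent_map D x E f)"
proof -
  let ?T = "tangent_map D x E f"
  note lin = linear_map_tangent_map[OF f, of x]
  have "(n, U, compose U ?T p) \<in> tangent_diffeology Y E (f x)"
    if p: "(n, U, p) \<in> tangent_diffeology X D x" for n U p
  proof -
    note p' = p[unfolded tangent_diffeology_iff]
    have "(n, U, \<lambda>u\<in>U. (f x, compose U ?T p u)) \<in> \<E>" if \<E>: "\<E> \<in> bundle_diffeologies Y E" for \<E>
    proof -
      \<comment> \<open>A plot of the fibre belongs to every admissible diffeology of TX, in
        particular to the one pulled back from \<E>.\<close>
      have "(n, U, compose U (bundle_map D E f) (\<lambda>u\<in>U. (x, p u))) \<in> \<E>"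
        using p' pullback_bundle_diffeology[OF D f \<E>] by (auto simp: pullback_diffeology_def)
      moreover have "compose U (bundle_map D E f) (\<lambda>u\<in>U. (x, p u)) = (\<lambda>u\<in>U. (f x, compose U ?T p u))"
        by (rule extensionalityI[of _ U]) (simp_all add: compose_def bundle_map_def)
      ultimately show ?thesis by simp
    qed
    moreover have "compose U ?T p \<in> U \<rightarrow>\<^sub>E carrier (tangent_space E (f x))"
      using p' linear_map_carrier[OF lin] by (auto simp: compose_def)
    ultimately show ?thesis using p' by (simp add: tangent_diffeology_iff)
  qed
  then show ?thesis
    using lin by (simp add: smooth_linear_map_def smooth_map_def linear_map_def)
qed

text \<open>Plots of the fibre are plots of the bundle with constant base point \<open>x\<close>.
  Over such plots the smooth fibrewise operations of the bundle are the operations of the vector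
  space.\<close>

lemma diffeological_vector_space_tangent_space:
  assumes x: "x \<in> X"
  shows "diffeological_vector_space (tangent_space D x) (tangent_diffeology X D x)"
proof -
  let ?V = "tangent_space D x" and ?D = "tangent_diffeology X D x"
  note dif = diffeology_tangent_diffeology[OF x]
  have "(n, U, compose U (\<lambda>(v, w). v \<oplus>\<^bsub>?V\<^esub> w) p) \<in> ?D"
    if p: "(n, U, p) \<in> product_diffeology ?D ?D" for n U p
  proof -
    note p' = product_plotD(1,2)[OF p]
    have "(n, U, \<lambda>u\<in>U. (x, compose U (\<lambda>(v, w). v \<oplus>\<^bsub>?V\<^esub> w) p u)) \<in> \<E>"
      if \<E>: "\<E> \<in> bundle_diffeologies X D" for \<E>
    proof -
      let ?s = "\<lambda>u\<in>U. (x, (\<lambda>u\<in>U. fst (p u)) u)" and ?t = "\<lambda>u\<in>U. (x, (\<lambda>u\<in>U. snd (p u)) u)"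
      have "(n, U, \<lambda>u\<in>U. (fst (?s u), snd (?s u) \<oplus>\<^bsub>tangent_space D (fst (?s u))\<^esub> snd (?t u))) \<in> \<E>"
      proof (rule bundle_add[OF \<E>])
        show "(n, U, ?s) \<in> \<E>" using p'(1) \<E> unfolding tangent_diffeology_iff by blast
        show "(n, U, ?t) \<in> \<E>" using p'(2) \<E> unfolding tangent_diffeology_iff by blast
      qed simp
      moreover have "(\<lambda>u\<in>U. (fst (?s u), snd (?s u) \<oplus>\<^bsub>tangent_space D (fst (?s u))\<^esub> snd (?t u))) =
          (\<lambda>u\<in>U. (x, compose U (\<lambda>(v, w). v \<oplus>\<^bsub>?V\<^esub> w) p u))"
        by (rule extensionalityI[of _ U]) (simp_all add: compose_def split_beta)
      ultimately show ?thesis by simp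
    qed
    moreover have "compose U (\<lambda>(v, w). v \<oplus>\<^bsub>?V\<^esub> w) p \<in> U \<rightarrow>\<^sub>E carrier ?V"
      using plot_in_space[OF dif p'(1)] plot_in_space[OF dif p'(2)]
      by (auto simp: compose_def split_beta intro: tangent_add_closed)
    ultimately show ?thesis using plot_openin[OF dif p'(1)] by (simp add: tangent_diffeology_iff)
  qed
  moreover have "(n, U, compose U (\<lambda>(r, v). r \<odot>\<^bsub>?V\<^esub> v) p) \<in> ?D"
    if p: "(n, U, p) \<in> product_diffeology real_diffeology ?D" for n U p
  proof -
    note p' = product_plotD(1,2)[OF p]
    have "(n, U, \<lambda>u\<in>U. (x, compose U (\<lambda>(r, v). r \<odot>\<^bsub>?V\<^esub> v) p u)) \<in> \<E>"
      if \<E>: "\<E> \<in> bundle_diffeologies X D" for \<E>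
    proof -
      let ?r = "\<lambda>u\<in>U. fst (p u)" and ?t = "\<lambda>u\<in>U. (x, (\<lambda>u\<in>U. snd (p u)) u)"
      have "(n, U, \<lambda>u\<in>U. (fst (?t u), ?r u \<odot>\<^bsub>tangent_space D (fst (?t u))\<^esub> snd (?t u))) \<in> \<E>"
      proof (rule bundle_smult[OF \<E> p'(1)])
        show "(n, U, ?t) \<in> \<E>" using p'(2) \<E> unfolding tangent_diffeology_iff by blast
      qed
      moreover have "(\<lambda>u\<in>U. (fst (?t u), ?r u \<odot>\<^bsub>tangent_space D (fst (?t u))\<^esub> snd (?t u))) =
          (\<lambda>u\<in>U. (x, compose U (\<lambda>(r, v). r \<odot>\<^bsub>?V\<^esub> v) p u))"
        by (rule extensionalityI[of _ U]) (simp_all add: compose_def split_beta)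
      ultimately show ?thesis by simp
    qed
    moreover have "compose U (\<lambda>(r, v). r \<odot>\<^bsub>?V\<^esub> v) p \<in> U \<rightarrow>\<^sub>E carrier ?V"
      using plot_in_space[OF dif p'(2)]
      by (auto simp: compose_def split_beta intro: tangent_smult_closed)
    ultimately show ?thesis using plot_openin[OF dif p'(2)] by (simp add: tangent_diffeology_iff)
  qed
  ultimately show ?thesis
    unfolding diffeological_vector_space_def smooth_map_def
    using real_vector_space_tangent_space dif
    by (auto intro: tangent_add_closed tangent_smult_closed)
qed

section \<open>Actions and coinvariants\<close>

text \<open>Functoriality of T, with \<open>fix_x\<close> ensuring that each map returns to the
  fibre over \<open>x\<close>. A \<open>group_action\<close> is a homomorphism into
  \<open>BijGroup\<close>, whose elements are extensional, so the pointwise laws are upgraded to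
  equalities of functions through \<open>tangent_map_extensional\<close>.\<close>

lemma tangent_action:
  assumes D: "diffeology X D" and x: "x \<in> X" and H: "group_action H X \<phi>"
    and smooth: "\<And>h. h \<in> carrier H \<Longrightarrow> smooth_map X D X D (\<phi> h)"
    and fix_x: "\<And>h. h \<in> carrier H \<Longrightarrow> \<phi> h x = x"
  shows "group_action H (carrier (tangent_space D x)) (\<lambda>h. tangent_map D x D (\<phi> h))"
proof -
  interpret \<phi>: group_action H X \<phi> by (rule H)
  interpret group_hom H "BijGroup X" \<phi> by (rule \<phi>.group_hom)
  let ?V = "carrier (tangent_space D x)"
  let ?\<alpha> = "\<lambda>h. tangent_map D x D (\<phi> h)"
  have closed: "?\<alpha> h t \<in> ?V" if "h \<in> carrier H" "t \<in> ?V" for h t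
    using linear_map_carrier[OF linear_map_tangent_map[OF smooth[OF that(1)], of x] that(2)]
      fix_x[OF that(1)] by simp
  have mult: "?\<alpha> (g \<otimes>\<^bsub>H\<^esub> h) t = ?\<alpha> g (?\<alpha> h t)"
    if g: "g \<in> carrier H" and h: "h \<in> carrier H" and t: "t \<in> ?V" for g h t
    using tangent_map_compose[OF D smooth[OF h] smooth[OF g] smooth[OF G.m_closed[OF g h]] x _ t]
      \<phi>.composition_rule[OF _ g h] fix_x[OF h] by simp
  have one: "?\<alpha> \<one>\<^bsub>H\<^esub> t = t" if t: "t \<in> ?V" for t
    using tangent_map_id[OF D x smooth[OF G.one_closed] _ t] fun_cong[OF \<phi>.id_eq_one]
    by (metis restrict_apply')
  have bij: "?\<alpha> h \<in> Bij ?V" if h: "h \<in> carrier H" for h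
  proof -
    have "bij_betw (?\<alpha> h) ?V ?V"
    proof (rule bij_betw_byWitness[where f' = "?\<alpha> (inv\<^bsub>H\<^esub> h)"])
      show "\<forall>t\<in>?V. ?\<alpha> (inv\<^bsub>H\<^esub> h) (?\<alpha> h t) = t"
        using mult[OF G.inv_closed[OF h] h] one h by simp
      show "\<forall>t\<in>?V. ?\<alpha> h (?\<alpha> (inv\<^bsub>H\<^esub> h) t) = t"
        using mult[OF h G.inv_closed[OF h]] one h by simp
      show "?\<alpha> h ` ?V \<subseteq> ?V" using closed[OF h] by blast
      show "?\<alpha> (inv\<^bsub>H\<^esub> h) ` ?V \<subseteq> ?V" using closed[OF G.inv_closed[OF h]] by blast
    qed
    then show ?thesis
      using tangent_map_extensional[OF smooth[OF h]] by (simp add: Bij_def)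
  qed
  have "?\<alpha> \<in> hom H (BijGroup ?V)"
  proof (rule homI)
    show "?\<alpha> h \<in> carrier (BijGroup ?V)" if "h \<in> carrier H" for h
      using bij[OF that] by (simp add: BijGroup_def)
    fix g h assume g: "g \<in> carrier H" and h: "h \<in> carrier H"
    have "?\<alpha> (g \<otimes>\<^bsub>H\<^esub> h) = compose ?V (?\<alpha> g) (?\<alpha> h)"
      using tangent_map_extensional[OF smooth[OF G.m_closed[OF g h]]] mult[OF g h]
      by (intro extensionalityI[of _ ?V]) (simp_all add: compose_eq)
    then show "?\<alpha> (g \<otimes>\<^bsub>H\<^esub> h) = ?\<alpha> g \<otimes>\<^bsub>BijGroup ?V\<^esub> ?\<alpha> h"
      using bij[OF g] bij[OF h] by (simp add: BijGroup_def)
  qed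
  then show ?thesis
    by (intro group_action.intro group_hom.intro group_hom_axioms.intro group_BijGroup G.group_axioms)
qed

lemma smooth_linear_action_tangent:
  assumes D: "diffeology X D" and x: "x \<in> X" and H: "group_action H X \<phi>"
    and smooth: "\<And>h. h \<in> carrier H \<Longrightarrow> smooth_map X D X D (\<phi> h)"
    and fix_x: "\<And>h. h \<in> carrier H \<Longrightarrow> \<phi> h x = x"
  shows "smooth_linear_action H (tangent_space D x) (tangent_diffeology X D x)
    (\<lambda>h. tangent_map D x D (\<phi> h))"
proof -
  have "smooth_linear_map (tangent_space D x) (tangent_diffeology X D x)
      (tangent_space D x) (tangent_diffeology X D x) (tangent_map D x D (\<phi> h))"
    if h: "h \<in> carrier H" for h
    using smooth_linear_map_tangent_map[OF D smooth[OF h], of x] fix_x[OF h] by simp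
  then show ?thesis
    unfolding smooth_linear_action_def
    using diffeological_vector_space_tangent_space[OF x] tangent_action[OF assms] by blast
qed

text \<open>Universal property of coinvariants: an invariant \<open>f\<close> kills each
  \<open>v\<close> minus its translate, hence their span. The resulting linear map is smooth by the
  universal property of the quotient diffeology.\<close>

lemma coinvariants_lift:
  assumes action: "smooth_linear_action H V D \<alpha>"
    and W: "diffeological_vector_space W E" and f: "smooth_linear_map V D W E f"
    and inv: "\<And>h v. h \<in> carrier H \<Longrightarrow> v \<in> carrier V \<Longrightarrow> f (\<alpha> h v) = f v"
  shows "\<exists>F. smooth_linear_map (coinvariants H V \<alpha>) (coinvariants_diffeology H V D \<alpha>) W E F \<and>
    (\<forall>v\<in>carrier V. F (coinvariant_class H V \<alpha> v) = f v)"
proof -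
  let ?S = "{v \<ominus>\<^bsub>V\<^esub> \<alpha> h v |v h. v \<in> carrier V \<and> h \<in> carrier H}"
  have V: "real_vector_space V" and D: "diffeology (carrier V) D"
    using action by (simp_all add: smooth_linear_action_def diffeological_vector_space_def)
  have W': "real_vector_space W" and E: "diffeology (carrier W) E"
    using W by (simp_all add: diffeological_vector_space_def)
  have lin: "linear_map V W f" and smooth: "smooth_map (carrier V) D (carrier W) E f"
    using f by (simp_all add: smooth_linear_map_def)
  interpret V: module real_ring V by (rule V)
  interpret W: module real_ring W by (rule W')
  have \<alpha>: "\<alpha> h v \<in> carrier V" if "h \<in> carrier H" "v \<in> carrier V" for h v
    using action that by (auto simp: smooth_linear_action_def smooth_linear_map_def intro: linear_map_carrier)
  have S: "?S \<subseteq> carrier V" using \<alpha> by auto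
  interpret N: real_subspace V "coinvariant_relations H V \<alpha>"
    unfolding coinvariant_relations_def
    by (intro real_subspace.intro V submodule_linear_span S)
  have "?S \<subseteq> {v \<in> carrier V. f v = \<zero>\<^bsub>W\<^esub>}"
  proof clarify
    fix v h assume v: "v \<in> carrier V" and h: "h \<in> carrier H"
    have "f (v \<ominus>\<^bsub>V\<^esub> \<alpha> h v) = f v \<ominus>\<^bsub>W\<^esub> f v"
      using linear_map_minus[OF V W' lin v \<alpha>[OF h v]] inv[OF h v] by simp
    also have "\<dots> = \<zero>\<^bsub>W\<^esub>"
      using linear_map_carrier[OF lin v] by (simp add: a_minus_def W.M.r_neg)
    finally show "v \<ominus>\<^bsub>V\<^esub> \<alpha> h v \<in> carrier V \<and> f (v \<ominus>\<^bsub>V\<^esub> \<alpha> h v) = \<zero>\<^bsub>W\<^esub>"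
      using v \<alpha>[OF h v] by simp
  qed
  then have "coinvariant_relations H V \<alpha> \<subseteq> {v \<in> carrier V. f v = \<zero>\<^bsub>W\<^esub>}"
    unfolding coinvariant_relations_def
    by (intro linear_span_least submodule_kernel[OF V W' lin])
  then have null: "f v = \<zero>\<^bsub>W\<^esub>" if "v \<in> coinvariant_relations H V \<alpha>" for v
    using that by blast
  have "\<exists>F. linear_map (coinvariants H V \<alpha>) W F \<and>
      (\<forall>v\<in>carrier V. F (coinvariant_class H V \<alpha> v) = f v)"
    unfolding coinvariants_def coinvariant_class_def
    by (rule N.linear_map_quotient_lift[OF W' lin]) (rule null)
  then obtain F where F: "linear_map (coinvariants H V \<alpha>) W F"
    "\<forall>v\<in>carrier V. F (coinvariant_class H V \<alpha> v) = f v"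
    by (elim exE conjE)
  have "coinvariant_class H V \<alpha> ` carrier V = carrier (coinvariants H V \<alpha>)"
    by (simp add: coinvariants_def coinvariant_class_def N.quotient_space_simps)
  from smooth_map_from_quotient[OF D this E smooth] F
  have "smooth_linear_map (coinvariants H V \<alpha>) (coinvariants_diffeology H V D \<alpha>) W E F"
    by (simp add: smooth_linear_map_def coinvariants_diffeology_def)
  with F(2) show ?thesis by blast
qed

lemma (in group_action) stabilizer_group_action:
  assumes "x \<in> E"
  shows "group_action (stabilizer_group G \<phi> x) E \<phi>"
  using induced_action[OF stabilizer_subgroup[OF assms]]
  by (simp add: stabilizer_group_def)

text \<open>Applied to the stabilizer, this is the equation pi after \<open>\<phi> h\<close> equals
  pi on \<open>X\<close>, from which T(pi) inherits its invariance.\<close>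

lemma (in group_action) orbit_action_eq:
  assumes h: "h \<in> carrier G" and y: "y \<in> E"
  shows "orbit G \<phi> (\<phi> h y) = orbit G \<phi> y"
proof -
  have hy: "\<phi> h y \<in> E" using element_image[OF h y] by simp
  \<comment> \<open>\<open>orbit_trans\<close> requires all its points to lie in \<open>E\<close>,
    so orbits are first placed there.\<close>
  have sub: "orbit G \<phi> z \<subseteq> E" if "z \<in> E" for z
    using element_image[OF _ that] by (auto simp: orbit_def)
  have 1: "\<phi> h y \<in> orbit G \<phi> y" using h by (auto simp: orbit_def)
  have 2: "y \<in> orbit G \<phi> (\<phi> h y)" by (rule orbit_sym[OF y hy 1])
  show ?thesis
    using orbit_trans[OF y hy _ 1] orbit_trans[OF hy y _ 2] sub[OF y] sub[OF hy] by blast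
qed

theorem proposition3p34:
  fixes X :: "'a set" and D :: "'a param set" and x :: 'a
    and G :: "('g, 'z) monoid_scheme" and \<phi> :: "'g \<Rightarrow> 'a \<Rightarrow> 'a"
  assumes "diffeology X D" and "x \<in> X"
    and "group G" and "pointwise_smooth_action G X D \<phi>"
  shows "let H = stabilizer_group G \<phi> x;
             \<pi> = orbit H \<phi>;
             Y = orbits H X \<phi>;
             E = orbit_diffeology H X D \<phi>;
             V = tangent_space D x;
             DV = tangent_diffeology X D x;
             W = tangent_space E (\<pi> x);
             DW = tangent_diffeology Y E (\<pi> x);
             \<alpha> = (\<lambda>g. tangent_map D x D (\<phi> g))
         in smooth_linear_action H V DV \<alpha> \<and>
            (\<exists>F. smooth_linear_map (coinvariants H V \<alpha>) (coinvariants_diffeology H V DV \<alpha>) W DW F \<and>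
                 (\<forall>v\<in>carrier V. F (coinvariant_class H V \<alpha> v) = tangent_map D x E \<pi> v))"
proof -
  define H where "H = stabilizer_group G \<phi> x"
  define E where "E = orbit_diffeology H X D \<phi>"
  interpret G: group_action G X \<phi>
    using assms(4) by (simp add: pointwise_smooth_action_def)
  interpret H: group_action H X \<phi>
    unfolding H_def by (rule G.stabilizer_group_action[OF assms(2)])
  have stab: "h \<in> carrier G" "\<phi> h x = x" if "h \<in> carrier H" for h
    using that by (simp_all add: H_def stabilizer_group_def stabilizer_def)
  have smooth: "smooth_map X D X D (\<phi> h)" if "h \<in> carrier H" for h
    using assms(4) stab(1)[OF that] by (simp add: pointwise_smooth_action_def)
  have action: "smooth_linear_action H (tangent_space D x) (tangent_diffeology X D x)
      (\<lambda>h. tangent_map D x D (\<phi> h))"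
    using assms(1,2) H.group_action_axioms smooth stab(2) by (rule smooth_linear_action_tangent)
  have \<pi>: "orbit H \<phi> ` X = orbits H X \<phi>" by (auto simp: orbits_def)
  have E: "diffeology (orbits H X \<phi>) E" and smooth_\<pi>: "smooth_map X D (orbits H X \<phi>) E (orbit H \<phi>)"
    unfolding E_def orbit_diffeology_def
    by (rule diffeology_quotient[OF assms(1) \<pi>], rule smooth_map_quotient[OF assms(1) \<pi>])
  have inv: "tangent_map D x E (orbit H \<phi>) (tangent_map D x D (\<phi> h) v) = tangent_map D x E (orbit H \<phi>) v"
    if h: "h \<in> carrier H" and v: "v \<in> carrier (tangent_space D x)" for h v
    \<comment> \<open>Functoriality with pi both as outer map and as composite. Since
      \<open>h\<close> fixes \<open>x\<close>, the fibre in the middle is again the one over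
      \<open>x\<close>.\<close>
    using tangent_map_compose[OF assms(1) smooth[OF h] smooth_\<pi> smooth_\<pi> assms(2) _ v]
      H.orbit_action_eq[OF h] stab(2)[OF h] by simp
  have "orbit H \<phi> x \<in> orbits H X \<phi>" using \<pi> assms(2) by blast
  then have "\<exists>F. smooth_linear_map
        (coinvariants H (tangent_space D x) (\<lambda>g. tangent_map D x D (\<phi> g)))
        (coinvariants_diffeology H (tangent_space D x) (tangent_diffeology X D x)
          (\<lambda>g. tangent_map D x D (\<phi> g)))
        (tangent_space E (orbit H \<phi> x)) (tangent_diffeology (orbits H X \<phi>) E (orbit H \<phi> x)) F \<and>
      (\<forall>v\<in>carrier (tangent_space D x).
        F (coinvariant_class H (tangent_space D x) (\<lambda>g. tangent_map D x D (\<phi> g)) v) =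
        tangent_map D x E (orbit H \<phi>) v)"
    by (intro coinvariants_lift[OF action diffeological_vector_space_tangent_space
          smooth_linear_map_tangent_map[OF assms(1) smooth_\<pi>]] inv)
  with action show ?thesis
    unfolding Let_def H_def E_def by (rule conjI)
qed

end
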